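(* Suppose $X$ is a compact metric space and $G$ is a finite subset of $X\times X$ such that $p_1(G)\subseteq p_2(G)$, and let $\sigma$ be the shift map on $\star_{i=1}^{\infty}G^{-1}$. Then the following are equivalent. (1) $\mathrm{ent}(G)\neq 0$. (2) $(\star_{i=1}^{\infty}G^{-1},\sigma)$ is Li-Yorke chaotic. (3) $(\star_{i=1}^{\infty}G^{-1},\sigma)$ has a DC2-scrambled Cantor set.
   Context: $p_1,p_2:X\times X\to X$ are the projections $p_1(s,t)=s$, $p_2(s,t)=t$. Mahavier products: for each positive integer $m$, $$\star_{i=1}^{m}G^{-1}=\{(x_1,\ldots,x_{m+1})\in X^{m+1} : (x_{i+1},x_i)\in G \text{ for each } i\in\{1,\ldots,m\}\},$$ and $$\star_{i=1}^{\infty}G^{-1}=\{(x_1,x_2,x_3,\ldots)\in \prod_{i=1}^{\infty}X : (x_{i+1},x_i)\in G \text{ for each positive integer } i\}.$$ The space $\star_{i=1}^{\infty}G^{-1}$ carries the subspace topology from the product $\prod_{i=1}^\infty X$ and any metric inducing it. The shift map $\sigma:\star_{i=1}^{\infty}G^{-1}\to\star_{i=1}^{\infty}G^{-1}$ is $\sigma(x_1,x_2,x_3,\ldots)=(x_2,x_3,x_4,\ldots)$. Entropy: for a non-empty open cover $\alpha$ of $X$ and a positive integer $n$ let $\alpha^{n}=\{S_1\times\cdots\times S_n : S_1,\ldots,S_n\in\alpha\}$. For a closed $K\subseteq X^n$ and a non-empty family $\mathcal U$ of open subsets of $X^n$ covering $K$, $N(K,\mathcal U)$ is the minimal cardinality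 of a non-empty subfamily of $\mathcal U$ that covers $K$. Define $\mathrm{ent}(G,\alpha)=\lim_{m\to\infty}\frac{\log N(\star_{i=1}^{m}G^{-1},\alpha^{m+1})}{m}$ (this limit is known to exist), and $\mathrm{ent}(G)=\sup_\alpha \mathrm{ent}(G,\alpha)\in[0,\infty]$, the supremum over all non-empty open covers $\alpha$ of $X$ (equal to $\infty$ if the set of values is unbounded). In particular $\mathrm{ent}(\emptyset)=0$. Chaos: let $Y$ be a compact metric space with metric $\rho$ and $f:Y\to Y$ continuous. For $x\neq y$ in $Y$, $\{x,y\}$ is a Li-Yorke pair for $f$ if $\liminf_{n}\rho(f^n(x),f^n(y))=0$ and $\limsup_{n}\rho(f^n(x),f^n(y))>0$. It is a DC2-pair for $f$ if $\liminf_n \frac1n\sum_{i=1}^{n}\rho(f^i(x),f^i(y))=0$ and $\limsup_n \frac1n\sum_{i=1}^{n}\rho(f^i(x),f^i(y))>0$. A set $S\subseteq Y$ is a scrambled set (respectively DC2-scrambled set) in $(Y,f)$ if $\{x,y\}$ is a Li-Yorke pair (respectively DC2-pair) for $f$ for all $x,y\in S$ with $x\neq y$. $(Y,f)$ is Li-Yorke chaotic if $Y$ contains an uncountable scrambled set. A DC2-scrambled Cantor set is a DC2-scrambled set that is homeomorphic to the Cantor set. *)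

theory Defs
  imports "HOL-Analysis.Analysis"
begin

section \<open>Mahavier products\<close>

text \<open>
  Coordinates are numbered from 0, so the \<open>i\<close>-th coordinate below is \<open>x\<^sub>i\<^sub>+\<^sub>1\<close> in the usual
  notation. Points of the \<open>n\<close>-fold product of \<open>X\<close> are the extensional functions on
  \<open>{..<n}\<close>; the product of \<open>m\<close> factors \<open>G\<inverse>\<close> has \<open>m + 1\<close> coordinates.
\<close>

definition mahavier_fin :: "'a set \<Rightarrow> ('a \<times> 'a) set \<Rightarrow> nat \<Rightarrow> (nat \<Rightarrow> 'a) set" where
  "mahavier_fin X G m = {x \<in> {..<Suc m} \<rightarrow>\<^sub>E X. \<forall>i<m. (x (Suc i), x i) \<in> G}"

definition mahavier_inf :: "'a set \<Rightarrow> ('a \<times> 'a) set \<Rightarrow> (nat \<Rightarrow> 'a) set" where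
  "mahavier_inf X G = {x. (\<forall>i. x i \<in> X) \<and> (\<forall>i. (x (Suc i), x i) \<in> G)}"

definition mahavier_topology :: "'a topology \<Rightarrow> ('a \<times> 'a) set \<Rightarrow> (nat \<Rightarrow> 'a) topology" where
  "mahavier_topology T G =
     subtopology (product_topology (\<lambda>_. T) UNIV) (mahavier_inf (topspace T) G)"

definition shift :: "(nat \<Rightarrow> 'a) \<Rightarrow> (nat \<Rightarrow> 'a)" where
  "shift x = (\<lambda>i. x (Suc i))"


section \<open>Entropy of a relation\<close>

definition nonempty_open_cover :: "'a topology \<Rightarrow> 'a set set \<Rightarrow> bool" where
  "nonempty_open_cover T \<alpha> \<longleftrightarrow> \<alpha> \<noteq> {} \<and> (\<forall>S\<in>\<alpha>. openin T S) \<and> \<Union>\<alpha> = topspace T"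

definition cover_power :: "'a set set \<Rightarrow> nat \<Rightarrow> (nat \<Rightarrow> 'a) set set" where
  "cover_power \<alpha> n = {Pi\<^sub>E {..<n} S | S. S \<in> {..<n} \<rightarrow> \<alpha>}"

text \<open>
  Only finite subfamilies are considered because \<open>card\<close> is 0 on infinite sets; a finite
  subcover exists whenever \<open>K\<close> is compact and \<open>U\<close> is an open cover of \<open>K\<close>.
  Since the subfamily is non-empty, \<open>min_cover_card {} U = 1\<close> for \<open>U \<noteq> {}\<close>.
\<close>

definition min_cover_card :: "'b set \<Rightarrow> 'b set set \<Rightarrow> nat" where
  "min_cover_card K U = Inf {card V | V. V \<subseteq> U \<and> V \<noteq> {} \<and> finite V \<and> K \<subseteq> \<Union>V}"

definition ent_cover :: "'a topology \<Rightarrow> ('a \<times> 'a) set \<Rightarrow> 'a set set \<Rightarrow> real" where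
  "ent_cover T G \<alpha> =
     lim (\<lambda>m. ln (real (min_cover_card (mahavier_fin (topspace T) G m) (cover_power \<alpha> (Suc m))))
              / real m)"

definition ent :: "'a topology \<Rightarrow> ('a \<times> 'a) set \<Rightarrow> ereal" where
  "ent T G = (SUP \<alpha> \<in> {\<alpha>. nonempty_open_cover T \<alpha>}. ereal (ent_cover T G \<alpha>))"


section \<open>Chaos\<close>

definition li_yorke_pair :: "('b \<Rightarrow> 'b \<Rightarrow> real) \<Rightarrow> ('b \<Rightarrow> 'b) \<Rightarrow> 'b \<Rightarrow> 'b \<Rightarrow> bool" where
  "li_yorke_pair \<rho> f x y \<longleftrightarrow> x \<noteq> y \<and>
     liminf (\<lambda>n. ereal (\<rho> ((f ^^ n) x) ((f ^^ n) y))) = 0 \<and>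
     limsup (\<lambda>n. ereal (\<rho> ((f ^^ n) x) ((f ^^ n) y))) > 0"

definition dc2_pair :: "('b \<Rightarrow> 'b \<Rightarrow> real) \<Rightarrow> ('b \<Rightarrow> 'b) \<Rightarrow> 'b \<Rightarrow> 'b \<Rightarrow> bool" where
  "dc2_pair \<rho> f x y \<longleftrightarrow> x \<noteq> y \<and>
     liminf (\<lambda>n. ereal (1 / real n * (\<Sum>i=1..n. \<rho> ((f ^^ i) x) ((f ^^ i) y)))) = 0 \<and>
     limsup (\<lambda>n. ereal (1 / real n * (\<Sum>i=1..n. \<rho> ((f ^^ i) x) ((f ^^ i) y)))) > 0"

definition scrambled :: "('b \<Rightarrow> 'b \<Rightarrow> real) \<Rightarrow> ('b \<Rightarrow> 'b) \<Rightarrow> 'b set \<Rightarrow> bool" where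
  "scrambled \<rho> f S \<longleftrightarrow> (\<forall>x\<in>S. \<forall>y\<in>S. x \<noteq> y \<longrightarrow> li_yorke_pair \<rho> f x y)"

definition dc2_scrambled :: "('b \<Rightarrow> 'b \<Rightarrow> real) \<Rightarrow> ('b \<Rightarrow> 'b) \<Rightarrow> 'b set \<Rightarrow> bool" where
  "dc2_scrambled \<rho> f S \<longleftrightarrow> (\<forall>x\<in>S. \<forall>y\<in>S. x \<noteq> y \<longrightarrow> dc2_pair \<rho> f x y)"

definition li_yorke_chaotic :: "'b set \<Rightarrow> ('b \<Rightarrow> 'b \<Rightarrow> real) \<Rightarrow> ('b \<Rightarrow> 'b) \<Rightarrow> bool" where
  "li_yorke_chaotic Y \<rho> f \<longleftrightarrow> (\<exists>S\<subseteq>Y. uncountable S \<and> scrambled \<rho> f S)"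

text \<open>The middle-thirds set, as the reals having a ternary expansion with digits 0 and 2 only.\<close>

definition cantor_set :: "real set" where
  "cantor_set = {\<Sum>n. 2 * of_bool (a n) / 3 ^ Suc n | a :: nat \<Rightarrow> bool. True}"

definition has_dc2_scrambled_cantor_set ::
    "'b set \<Rightarrow> ('b \<Rightarrow> 'b \<Rightarrow> real) \<Rightarrow> ('b \<Rightarrow> 'b) \<Rightarrow> bool" where
  "has_dc2_scrambled_cantor_set Y \<rho> f \<longleftrightarrow>
     (\<exists>S\<subseteq>Y. dc2_scrambled \<rho> f S \<and>
        subtopology (Metric_space.mtopology Y \<rho>) S homeomorphic_space top_of_set cantor_set)"

end

theory Submission
  imports Defs "HOL-Real_Asymp.Real_Asymp"
begin

text \<open>
  Since \<open>G\<close> is finite, the infinite Mahavier product is the space of infinite walks in a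
  finite directed graph, with the product topology of finite discrete spaces and the shift. All
  three conditions turn out to be equivalent to a combinatorial one, \<open>branching G\<close>: some
  vertex carries two different closed walks of the same length.

  Without branching, a closed walk is determined by its base point and its length. A finite walk
  is then determined by the times of the first and the last visit to each vertex, so the number
  of walks of length \<open>m\<close> is polynomial in \<open>m\<close> and the entropy is 0
  (\<open>not_branching_imp_ent_eq_0\<close>). Two closed walks at a common vertex moreover commute
  under concatenation, since both concatenations have the same length. This makes every infinite
  walk eventually periodic, so there are only countably many of them
  (\<open>not_branching_countable\<close>) and no uncountable scrambled set.

  With branching, two different closed walks \<open>a\<close> and \<open>b\<close> of length \<open>k\<close> at one
  vertex can be spliced in the order prescribed by any bit stream. There are at least
  \<open>2 ^ j\<close> walks of length \<open>k * j\<close>, so the entropy is at least \<open>ln 2 / k\<close>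
  with respect to a cover that separates the vertices (\<open>branching_imp_ent_neq_0\<close>). For
  chaos, the bit positions are cut into the blocks from \<open>fact n\<close> to
  \<open>fact (Suc n)\<close>; each block is so long that the average distance at its end is almost
  decided by that block alone. A parameter \<open>t\<close> is encoded by writing 0 on the odd blocks
  and repeating one bit of \<open>t\<close> throughout each even block, in such a way that every bit of
  \<open>t\<close> fills infinitely many blocks. Two parameters agree on the odd blocks, where the
  averages come close to 0, and differ on infinitely many whole even blocks, where the averages
  stay away from 0 (\<open>dc2_pair_point\<close>). The encoding is continuous and injective, so its image
  is a Cantor set. Finally a DC2-pair is always a Li-Yorke pair and Cantor sets are uncountable,
  which leads from the third condition to the second.
\<close>

section \<open>Closed walks\<close>

text \<open>
  A pair \<open>(t, s) \<in> G\<close> is an arrow from \<open>s\<close> to \<open>t\<close>; with this direction the points of the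
  Mahavier products are the walks of a directed graph.
\<close>

definition closed_walk :: "('a \<times> 'a) set \<Rightarrow> 'a \<Rightarrow> nat \<Rightarrow> (nat \<Rightarrow> 'a) \<Rightarrow> bool" where
  "closed_walk G v k w \<longleftrightarrow> w 0 = v \<and> w k = v \<and> (\<forall>i<k. (w (Suc i), w i) \<in> G)"

definition branching :: "('a \<times> 'a) set \<Rightarrow> bool" where
  "branching G \<longleftrightarrow>
     (\<exists>v k a b. closed_walk G v k a \<and> closed_walk G v k b \<and> (\<exists>r<k. a r \<noteq> b r))"

lemma closed_walk_unique:
  assumes "\<not> branching G" "closed_walk G v k a" "closed_walk G v k b" "r \<le> k"
  shows "a r = b r"
proof (cases "r = k")
  case True
  then show ?thesis using assms by (auto simp: closed_walk_def)
next
  case False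
  then show ?thesis using assms unfolding branching_def by (metis le_neq_implies_less)
qed

lemma closed_walk_segment:
  assumes "\<And>i. m \<le> i \<Longrightarrow> i < n \<Longrightarrow> (x (Suc i), x i) \<in> G" "x m = v" "x n = v" "m \<le> n"
  shows "closed_walk G v (n - m) (\<lambda>i. x (m + i))"
  using assms by (auto simp: closed_walk_def)

lemma closed_walk_append:
  assumes "closed_walk G v p a" "closed_walk G v q b"
  shows "closed_walk G v (p + q) (\<lambda>i. if i < p then a i else b (i - p))"
proof -
  have "((if Suc i < p then a (Suc i) else b (Suc i - p)), if i < p then a i else b (i - p)) \<in> G"
    if "i < p + q" for i
  proof -
    consider "Suc i < p" | "Suc i = p" | "p \<le> i" by linarith
    then show ?thesis
    proof cases
      case 2
      then have "(a p, a i) \<in> G" using assms(1) by (auto simp: closed_walk_def)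
      then show ?thesis using 2 assms by (auto simp: closed_walk_def)
    next
      case 3
      then have "(b (Suc (i - p)), b (i - p)) \<in> G"
        using assms(2) that unfolding closed_walk_def by simp
      then show ?thesis using 3 by (simp add: Suc_diff_le)
    qed (use assms in \<open>auto simp: closed_walk_def\<close>)
  qed
  then show ?thesis using assms by (auto simp: closed_walk_def)
qed

section \<open>Relations without branching\<close>

text \<open>
  Some vertex is visited infinitely often. The walk \<open>c\<close> between two of the
  visits and the walk \<open>u\<close> from the second of them to any later visit satisfy
  \<open>c u = u c\<close>, as both sides are closed walks of the same length. Comparing entries shows
  that \<open>c\<close> is repeated as long as \<open>u\<close> lasts.
\<close>

lemma not_branching_eventually_periodic:
  assumes nb: "\<not> branching G" and "finite G" and x: "x \<in> mahavier_inf X G"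
  shows "\<exists>n p. 0 < p \<and> (\<forall>i\<ge>n. x (i + p) = x i)"
proof -
  have E: "(x (Suc i), x i) \<in> G" for i using x by (simp add: mahavier_inf_def)
  then have "range x \<subseteq> snd ` G" by force
  then have "finite (range x)" using \<open>finite G\<close> finite_subset by blast
  then obtain v where "infinite {i. x i = v}"
    using pigeonhole_infinite[of UNIV x] by auto
  then have visit: "\<exists>i>m. x i = v" for m
    by (metis (mono_tags, lifting) finite_nat_set_iff_bounded_le mem_Collect_eq not_le)
  obtain m where m: "x m = v" using visit by blast
  obtain n where n: "m < n" "x n = v" using visit by blast
  define p where "p = n - m"
  have "x (i + p) = x i" if "i \<ge> m" for i
  proof -
    obtain l where l: "n + i < l" "x l = v" using visit by blast
    have cp: "closed_walk G v p (\<lambda>i. x (m + i))"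
      unfolding p_def using closed_walk_segment[of m n x G v] E m n by simp
    have cq: "closed_walk G v (l - n) (\<lambda>i. x (n + i))"
      using closed_walk_segment[of n l x G v] E n l by simp
    have c: "closed_walk G v (l - m) (\<lambda>i. x (m + i))"
      using closed_walk_segment[of m l x G v] E m n l by simp
    have "l - m = l - n + p" using n l by (simp add: p_def)
    \<comment> \<open>The two pieces are traversed in the opposite order.\<close>
    then have "closed_walk G v (l - m) (\<lambda>i. if i < l - n then x (n + i) else x (m + (i - (l - n))))"
      using closed_walk_append[OF cq cp] by simp
    from closed_walk_unique[OF nb this c, of "i - m"]
    moreover have "i - m \<le> l - m" "i - m < l - n" "n + (i - m) = i + p" "m + (i - m) = i"
      using l n that by (auto simp: p_def)
    ultimately show ?thesis by simp
  qed
  moreover have "0 < p" using n by (simp add: p_def)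
  ultimately show ?thesis by blast
qed

lemma not_branching_countable:
  assumes nb: "\<not> branching G" and "finite G"
  shows "countable (mahavier_inf X G)"
proof -
  define P where "P n p = {x \<in> mahavier_inf X G. \<forall>i\<ge>n. x (i + p) = x i}" for n p
  have "mahavier_inf X G \<subseteq> (\<Union>n. \<Union>p\<in>{0<..}. P n p)"
    using not_branching_eventually_periodic[OF assms] unfolding P_def by fastforce
  moreover have "countable (P n p)" if "0 < p" for n p
  proof (rule countableI')
    let ?h = "\<lambda>x. map x [0..<n + p]"
    let ?L = "lists (snd ` G)"
    have "inj_on ?h (P n p)"
    proof (rule inj_onI, rule ext)
      \<comment> \<open>The entries before \<open>n + p\<close> determine the rest by periodicity.\<close>
      fix x y i
      assume xy: "x \<in> P n p" "y \<in> P n p" "?h x = ?h y"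
      show "x i = y i"
      proof (induction i rule: less_induct)
        case (less i)
        show ?case
        proof (cases "i < n + p")
          case True
          then show ?thesis using xy(3) by (simp add: map_eq_conv)
        next
          case False
          then have "n \<le> i - p" "i - p + p = i" by linarith+
          then have "x i = x (i - p)" "y i = y (i - p)"
            using xy(1,2) unfolding P_def by (metis (mono_tags, lifting) mem_Collect_eq)+
          then show ?thesis using less[of "i - p"] \<open>0 < p\<close> False by simp
        qed
      qed
    qed
    moreover have "?h ` P n p \<subseteq> ?L" by (auto simp: P_def mahavier_inf_def) force
    moreover have "countable ?L" using \<open>finite G\<close> by (simp add: countable_finite)
    ultimately show "inj_on (to_nat_on ?L \<circ> ?h) (P n p)"
      by (meson comp_inj_on inj_on_subset inj_on_to_nat_on)
  qed
  then have "countable (\<Union>n. \<Union>p\<in>{0<..}. P n p)" by auto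
  ultimately show ?thesis by (rule countable_subset)
qed

lemma mahavier_fin_vertex:
  assumes "m > 0" "x \<in> mahavier_fin X G m" "i \<le> m"
  shows "x i \<in> fst ` G \<union> snd ` G"
proof (cases "i = m")
  case True
  then have "(x i, x (i - 1)) \<in> G" using assms unfolding mahavier_fin_def
    by (metis (no_types, lifting) Suc_pred' lessI mem_Collect_eq)
  then show ?thesis by force
next
  case False
  then have "(x (Suc i), x i) \<in> G" using assms unfolding mahavier_fin_def by simp
  then show ?thesis by force
qed

lemma finite_mahavier_fin:
  assumes "finite G" "m > 0"
  shows "finite (mahavier_fin X G m)"
proof -
  have "x \<in> {..<Suc m} \<rightarrow>\<^sub>E (fst ` G \<union> snd ` G)" if "x \<in> mahavier_fin X G m" for x
    using mahavier_fin_vertex[OF \<open>m > 0\<close> that] that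
    by (simp add: PiE_iff mahavier_fin_def less_Suc_eq_le)
  then have "mahavier_fin X G m \<subseteq> {..<Suc m} \<rightarrow>\<^sub>E (fst ` G \<union> snd ` G)" by blast
  then show ?thesis
    using assms by (meson finite_PiE finite_UnI finite_imageI finite_lessThan finite_subset)
qed

text \<open>
  A walk can be reconstructed from its first and last visits to the vertices: position \<open>i\<close>
  lies between the first and the last visit to the vertex found there, and in between the walk is
  a closed one of known base point and length.
\<close>

lemma not_branching_card_le:
  assumes nb: "\<not> branching G" and "finite G" and "m > 0"
  shows "card (mahavier_fin X G m) \<le> ((m + 2) * (m + 2)) ^ card (fst ` G \<union> snd ` G)"
proof -
  let ?V = "fst ` G \<union> snd ` G"
  let ?W = "mahavier_fin X G m"
  define visits where "visits x v = {i. i \<le> m \<and> x i = v}" for x :: "nat \<Rightarrow> 'a" and v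
  have fin: "finite (visits x v)" for x v by (simp add: visits_def)
  \<comment> \<open>The default \<open>Suc m\<close> for the first visit reveals that a vertex is never visited.\<close>
  define first where "first x v = Min (insert (Suc m) (visits x v))" for x v
  define final where "final x v = Max (insert 0 (visits x v))" for x v
  let ?F = "\<lambda>x. restrict (\<lambda>v. (first x v, final x v)) ?V"
  have "inj_on ?F ?W"
  proof (rule inj_onI)
    fix x y assume xy: "x \<in> ?W" "y \<in> ?W" "?F x = ?F y"
    have same: "first x v = first y v" "final x v = final y v" if "v \<in> ?V" for v
      using fun_cong[OF xy(3), of v] that by auto
    have "x i = y i" if "i \<le> m" for i
    proof -
      let ?v = "x i"
      let ?f = "first x ?v" and ?l = "final x ?v"
      have V: "?v \<in> ?V" using mahavier_fin_vertex[OF \<open>m > 0\<close> xy(1) that] .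
      have vis: "i \<in> visits x ?v" using that by (simp add: visits_def)
      have attained: "first z ?v \<in> visits z ?v \<and> final z ?v \<in> visits z ?v"
        if "visits z ?v \<noteq> {}" for z
      proof -
        have "Min (visits z ?v) \<in> visits z ?v" "Max (visits z ?v) \<in> visits z ?v"
          using that fin by simp_all
        moreover from this have "first z ?v = Min (visits z ?v)" "final z ?v = Max (visits z ?v)"
          using that fin by (auto simp: first_def final_def visits_def Min_insert Max_insert min_def)
        ultimately show ?thesis by simp
      qed
      have x': "?f \<in> visits x ?v" "?l \<in> visits x ?v" using attained vis by blast+
      then have "?f \<le> m" by (simp add: visits_def)
      have le: "?f \<le> i" "i \<le> ?l" using vis fin by (auto simp: first_def final_def)
      have "visits y ?v \<noteq> {}"
      proof
        assume "visits y ?v = {}"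
        then have "first y ?v = Suc m" by (simp add: first_def)
        then show False using same(1)[OF V] \<open>?f \<le> m\<close> by simp
      qed
      then have y': "?f \<in> visits y ?v" "?l \<in> visits y ?v"
        using attained same[OF V] by (metis)+
      have "closed_walk G ?v (?l - ?f) (\<lambda>i. x (?f + i))"
        "closed_walk G ?v (?l - ?f) (\<lambda>i. y (?f + i))"
        using x' y' le xy(1,2)
        by (auto intro!: closed_walk_segment simp: visits_def mahavier_fin_def)
      from closed_walk_unique[OF nb this, of "i - ?f"] show ?thesis
        using le by simp
    qed
    moreover have "x \<in> extensional {..<Suc m}" "y \<in> extensional {..<Suc m}"
      using xy by (auto simp: mahavier_fin_def PiE_def)
    ultimately show "x = y" by (metis extensionalityI lessThan_iff less_Suc_eq_le)
  qed
  moreover have "?F ` ?W \<subseteq> ?V \<rightarrow>\<^sub>E ({..<m + 2} \<times> {..<m + 2})" (is "_ \<subseteq> ?T")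
  proof -
    have "first x v \<le> Suc m" "final x v \<le> Suc m" for x v
      using fin[of x v] by (auto simp: first_def final_def) (auto simp: visits_def)
    then show ?thesis by (simp add: image_subset_iff restrict_PiE_iff less_Suc_eq_le)
  qed
  moreover have fV: "finite ?V" using \<open>finite G\<close> by simp
  then have "finite ?T" by (intro finite_PiE) auto
  ultimately have "card ?W \<le> card ?T" using card_inj_on_le by blast
  also have "\<dots> = ((m + 2) * (m + 2)) ^ card ?V"
    using fV by (simp add: card_PiE)
  finally show ?thesis .
qed

section \<open>Splicing two closed walks\<close>

definition spliced_walk :: "nat \<Rightarrow> (nat \<Rightarrow> 'a) \<Rightarrow> (nat \<Rightarrow> 'a) \<Rightarrow> (nat \<Rightarrow> bool) \<Rightarrow> nat \<Rightarrow> 'a" where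
  "spliced_walk k a b u i = (if u (i div k) then a else b) (i mod k)"

lemma spliced_walk_in_mahavier_inf:
  assumes "closed_walk G v k a" "closed_walk G v k b" "k > 0" "G \<subseteq> X \<times> X"
  shows "spliced_walk k a b u \<in> mahavier_inf X G"
proof -
  have E: "(spliced_walk k a b u (Suc i), spliced_walk k a b u i) \<in> G" for i
  proof (cases "Suc (i mod k) = k")
    case True
    then have "Suc i mod k = 0" "i mod k = k - 1" by (simp add: mod_Suc, linarith)
    moreover have "(a k, a (k - 1)) \<in> G" "(b k, b (k - 1)) \<in> G"
      using assms unfolding closed_walk_def by (metis Suc_pred' lessI)+
    ultimately show ?thesis
      using assms(1,2) by (auto simp: spliced_walk_def closed_walk_def)
  next
    case False
    then have "Suc (i mod k) < k" using \<open>k > 0\<close> by (simp add: Suc_lessI)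
    moreover from False have "Suc i mod k = Suc (i mod k)" "Suc i div k = i div k"
      by (simp_all add: mod_Suc div_Suc)
    ultimately show ?thesis
      using assms(1,2) by (auto simp: spliced_walk_def closed_walk_def)
  qed
  moreover have "spliced_walk k a b u i \<in> X" for i
    using E[of i] \<open>G \<subseteq> X \<times> X\<close> by blast
  ultimately show ?thesis by (simp add: mahavier_inf_def)
qed

lemma spliced_walk_differ:
  assumes "u j \<noteq> u' j" "r < k" "a r \<noteq> b r"
  shows "spliced_walk k a b u (k * j + r) \<noteq> spliced_walk k a b u' (k * j + r)"
  using assms by (auto simp: spliced_walk_def)

text \<open>
  The bits of a word of length \<open>j\<close> can be read off from the spliced walk, at the positions
  \<open>k * i + r\<close> where the two pieces differ.
\<close>

lemma branching_card_ge:
  assumes "closed_walk G v k a" "closed_walk G v k b" "r < k" "a r \<noteq> b r"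
    and "G \<subseteq> X \<times> X" "finite G" "j > 0"
  shows "2 ^ j \<le> card (mahavier_fin X G (k * j))"
proof -
  let ?U = "{..<j} \<rightarrow>\<^sub>E (UNIV :: bool set)"
  let ?h = "\<lambda>u. restrict (spliced_walk k a b u) {..<Suc (k * j)}"
  have "inj_on ?h ?U"
  proof (rule inj_onI)
    fix u u' assume u: "u \<in> ?U" "u' \<in> ?U" "?h u = ?h u'"
    have "u i = u' i" if "i < j" for i
    proof (rule ccontr)
      assume "u i \<noteq> u' i"
      have "k * i + r < k * Suc i" using \<open>r < k\<close> by simp
      also have "\<dots> \<le> k * j" using that by (intro mult_le_mono) auto
      finally have "k * i + r < Suc (k * j)" by simp
      then show False
        using fun_cong[OF u(3), of "k * i + r"]
          spliced_walk_differ[of u i u' r k a b] assms \<open>u i \<noteq> u' i\<close> by simp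
    qed
    then show "u = u'" using u by (intro PiE_ext) auto
  qed
  moreover have "?h ` ?U \<subseteq> mahavier_fin X G (k * j)"
    using spliced_walk_in_mahavier_inf[OF assms(1,2) _ assms(5)] \<open>r < k\<close>
    by (fastforce simp: mahavier_fin_def mahavier_inf_def)
  moreover have "finite (mahavier_fin X G (k * j))"
    using finite_mahavier_fin[OF \<open>finite G\<close>, of "k * j"] \<open>r < k\<close> \<open>j > 0\<close> by simp
  ultimately have "card ?U \<le> card (mahavier_fin X G (k * j))" using card_inj_on_le by blast
  then show ?thesis by (simp add: card_PiE)
qed

text \<open>
  Cutting a walk at time \<open>m\<close> gives two walks that share the vertex at the cut; this
  submultiplicativity yields the convergence in the definition of the entropy.
\<close>

lemma card_mahavier_fin_add:
  assumes "finite G" "m > 0" "n > 0"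
  shows "card (mahavier_fin X G (m + n))
           \<le> card (mahavier_fin X G m) * card (mahavier_fin X G n)"
proof -
  let ?h = "\<lambda>x. (restrict x {..<Suc m}, restrict (\<lambda>i. x (m + i)) {..<Suc n})"
  have "inj_on ?h (mahavier_fin X G (m + n))"
  proof (rule inj_onI)
    fix x y assume xy: "x \<in> mahavier_fin X G (m + n)" "y \<in> mahavier_fin X G (m + n)" "?h x = ?h y"
    have "x i = y i" if "i \<in> {..<Suc (m + n)}" for i
    proof (cases "i \<le> m")
      case True
      have "restrict x {..<Suc m} = restrict y {..<Suc m}" using xy(3) by simp
      from fun_cong[OF this, of i] show ?thesis using True by simp
    next
      case False
      have "restrict (\<lambda>i. x (m + i)) {..<Suc n} = restrict (\<lambda>i. y (m + i)) {..<Suc n}"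
        using xy(3) by simp
      moreover have "m + (i - m) = i" "i - m < Suc n" using False that by auto
      ultimately show ?thesis by (metis lessThan_iff restrict_apply')
    qed
    then show "x = y" using xy unfolding mahavier_fin_def
      by (intro PiE_ext[of x "{..<Suc (m + n)}" _ y]) auto
  qed
  moreover have "?h ` mahavier_fin X G (m + n) \<subseteq> mahavier_fin X G m \<times> mahavier_fin X G n"
    by (auto simp: mahavier_fin_def PiE_iff)
  moreover have "finite (mahavier_fin X G m \<times> mahavier_fin X G n)"
    using finite_mahavier_fin[OF \<open>finite G\<close>] assms by blast
  ultimately have "card (mahavier_fin X G (m + n)) \<le> card (mahavier_fin X G m \<times> mahavier_fin X G n)"
    using card_inj_on_le by blast
  then show ?thesis by (simp add: card_cartesian_product)
qed

section \<open>Subadditive sequences\<close>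

text \<open>
  Fekete's lemma: \<open>a n / n\<close> converges to its infimum. For an \<open>n\<close> that nearly attains
  the infimum, a large index is a multiple of \<open>n\<close> plus a bounded remainder, which does not
  matter after division.
\<close>

lemma convergent_subadditive_div:
  fixes a :: "nat \<Rightarrow> real"
  assumes sub: "\<And>m n. m > 0 \<Longrightarrow> n > 0 \<Longrightarrow> a (m + n) \<le> a m + a n" and nonneg: "\<And>n. n > 0 \<Longrightarrow> a n \<ge> 0"
  shows "convergent (\<lambda>n. a n / real n)"
proof -
  define L where "L = (INF n\<in>{0<..}. a n / real n)"
  have bdd: "bdd_below ((\<lambda>n. a n / real n) ` {0<..})"
    by (rule bdd_belowI[of _ 0]) (auto simp: nonneg)
  have mult: "a (q * n) \<le> real q * a n" if "q > 0" "n > 0" for q n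
    using that(1)
  proof (induction q rule: nat_induct_non_zero)
    case (Suc q)
    have "a (Suc q * n) \<le> a n + a (q * n)" using sub[of n "q * n"] Suc that by simp
    then show ?case using Suc by (simp add: algebra_simps)
  qed simp
  have "(\<lambda>n. a n / real n) \<longlonglongrightarrow> L"
  proof (rule LIMSEQ_I)
    fix e :: real assume "e > 0"
    then obtain n where n: "n > 0" "a n / real n < L + e / 2"
      using cINF_less_iff[OF _ bdd, of "L + e / 2"] by (auto simp: L_def)
    \<comment> \<open>Remainders are taken between 1 and \<open>n\<close>, because nothing is known about \<open>a 0\<close>.\<close>
    define C where "C = Max (a ` {1..n})"
    have C: "a r \<le> C" if "r \<in> {1..n}" for r using that by (simp add: C_def)
    have "C \<ge> 0" using C[of 1] nonneg[of 1] n by force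
    obtain N where N: "N > 0" "C / real N < e / 2"
    proof -
      obtain N where "C / (e / 2) < real (Suc N)"
        using reals_Archimedean2 by (metis less_trans lessI of_nat_less_iff)
      then show thesis using that[of "Suc N"] \<open>e > 0\<close> by (simp add: field_simps)
    qed
    have "norm (a m / real m - L) < e" if "m \<ge> max N (Suc n)" for m
    proof -
      define q where "q = (m - 1) div n"
      define r where "r = Suc ((m - 1) mod n)"
      have m: "m = q * n + r" using that by (simp add: q_def r_def)
      have r: "r \<in> {1..n}" using n by (simp add: r_def Suc_le_eq)
      have "q > 0" using that n by (auto simp: q_def div_greater_zero_iff)
      then have "a m \<le> real q * a n + C"
        using sub[of "q * n" r] mult[of q n] C[OF r] n r unfolding m by fastforce
      also have "real q * a n \<le> real m * (a n / real n)"
      proof -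
        have "real q * real n \<le> real m" unfolding m by simp
        then have "real q * real n * (a n / real n) \<le> real m * (a n / real n)"
          using nonneg n by (intro mult_right_mono) auto
        then show ?thesis using n by simp
      qed
      finally have "a m / real m \<le> a n / real n + C / real m"
        using that by (simp add: field_simps)
      moreover have "C / real m \<le> C / real N"
        using that N \<open>C \<ge> 0\<close> by (intro divide_left_mono) auto
      moreover have "L \<le> a m / real m"
        unfolding L_def using bdd that by (intro cINF_lower) auto
      ultimately show ?thesis using n(2) N(2) unfolding real_norm_def by linarith
    qed
    then show "\<exists>no. \<forall>m\<ge>no. norm (a m / real m - L) < e" by blast
  qed
  then show ?thesis by (rule convergentI)
qed

section \<open>Entropy and branching\<close>

lemma min_cover_card_le:
  assumes "finite V" "V \<subseteq> U" "V \<noteq> {}" "K \<subseteq> \<Union>V"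
  shows "min_cover_card K U \<le> card V"
  unfolding min_cover_card_def
  by (rule wellorder_Inf_le1, rule CollectI, rule exI[of _ V]) (simp add: assms)

lemma min_cover_card_le_card:
  assumes "finite K" "K \<noteq> {}" "K \<subseteq> \<Union>U"
  shows "min_cover_card K U \<le> card K"
proof -
  have "\<forall>x\<in>K. \<exists>P. x \<in> P \<and> P \<in> U" using assms(3) by blast
  then obtain f where f: "\<forall>x\<in>K. x \<in> f x \<and> f x \<in> U" by (auto dest!: bchoice)
  have "min_cover_card K U \<le> card (f ` K)"
    using f assms by (intro min_cover_card_le) auto
  also have "\<dots> \<le> card K" using assms card_image_le by blast
  finally show ?thesis .
qed

lemma mahavier_fin_subset_cover:
  assumes "nonempty_open_cover T \<alpha>"
  shows "mahavier_fin (topspace T) G m \<subseteq> \<Union> (cover_power \<alpha> (Suc m))"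
proof
  fix x assume x: "x \<in> mahavier_fin (topspace T) G m"
  then have "\<exists>S\<in>\<alpha>. x i \<in> S" if "i < Suc m" for i
    using that assms by (auto simp: mahavier_fin_def nonempty_open_cover_def)
  then have "\<forall>i\<in>{..<Suc m}. \<exists>S. S \<in> \<alpha> \<and> x i \<in> S" by blast
  then obtain S where "\<forall>i\<in>{..<Suc m}. S i \<in> \<alpha> \<and> x i \<in> S i" by (auto dest!: bchoice)
  then have "x \<in> Pi\<^sub>E {..<Suc m} S" "S \<in> {..<Suc m} \<rightarrow> \<alpha>"
    using x by (auto simp: mahavier_fin_def PiE_iff)
  then show "x \<in> \<Union> (cover_power \<alpha> (Suc m))" by (auto simp: cover_power_def)
qed

lemma cover_power_nonempty: "\<alpha> \<noteq> {} \<Longrightarrow> cover_power \<alpha> n \<noteq> {}"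
  by (force simp: cover_power_def)

lemma min_cover_card_mahavier_fin_le:
  assumes "nonempty_open_cover T \<alpha>" "finite G" "m > 0"
  shows "min_cover_card (mahavier_fin (topspace T) G m) (cover_power \<alpha> (Suc m))
           \<le> max 1 (card (mahavier_fin (topspace T) G m))"
proof (cases "mahavier_fin (topspace T) G m = {}")
  case True
  obtain P where "P \<in> cover_power \<alpha> (Suc m)"
    using cover_power_nonempty assms by (metis nonempty_open_cover_def ex_in_conv)
  then show ?thesis using min_cover_card_le[of "{P}"] True by fastforce
next
  case False
  then show ?thesis
    using min_cover_card_le_card[OF finite_mahavier_fin False mahavier_fin_subset_cover] assms
    by fastforce
qed

text \<open>
  For every cover, the covering number is at most the number of walks (or 1 if there are none), which
  grows at most polynomially.
\<close>

lemma not_branching_imp_ent_eq_0: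
  assumes "\<not> branching G" "finite G"
  shows "ent T G = 0"
proof -
  have "ent_cover T G \<alpha> = 0" if "nonempty_open_cover T \<alpha>" for \<alpha>
  proof -
    let ?c = "card (fst ` G \<union> snd ` G)"
    let ?N = "\<lambda>m. min_cover_card (mahavier_fin (topspace T) G m) (cover_power \<alpha> (Suc m))"
    have "ln (real (?N m)) \<le> real ?c * ln ((real m + 2)\<^sup>2)" if "m > 0" for m
    proof (cases "?N m = 0")
      case False
      have "1 \<le> ((m + 2) * (m + 2)) ^ ?c" by (rule one_le_power) simp
      then have "?N m \<le> ((m + 2) * (m + 2)) ^ ?c"
        using min_cover_card_mahavier_fin_le[OF \<open>nonempty_open_cover T \<alpha>\<close> \<open>finite G\<close> that]
          not_branching_card_le[OF assms that, of "topspace T"] by linarith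
      then have "real (?N m) \<le> real (((m + 2) * (m + 2)) ^ ?c)" by (rule of_nat_mono)
      also have "\<dots> = ((real m + 2)\<^sup>2) ^ ?c"
        by (simp only: of_nat_power of_nat_mult of_nat_add of_nat_numeral power2_eq_square)
      finally have "real (?N m) \<le> ((real m + 2)\<^sup>2) ^ ?c" .
      then have "ln (real (?N m)) \<le> ln (((real m + 2)\<^sup>2) ^ ?c)"
        using False by simp
      also have "\<dots> = real ?c * ln ((real m + 2)\<^sup>2)" by (simp add: ln_realpow)
      finally show ?thesis .
    qed simp
    then have upper: "\<forall>\<^sub>F m in sequentially.
        ln (real (?N m)) / real m \<le> real ?c * ln ((real m + 2)\<^sup>2) / real m"
      by (auto intro!: eventually_sequentiallyI[of 1] divide_right_mono)
    have lower: "\<forall>\<^sub>F m in sequentially. 0 \<le> ln (real (?N m)) / real m"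
    proof -
      have "0 \<le> ln (real n)" for n :: nat by (cases n) auto
      then show ?thesis by simp
    qed
    have "(\<lambda>m. real ?c * ln ((real m + 2)\<^sup>2) / real m) \<longlonglongrightarrow> 0"
    proof -
      have "(\<lambda>m. ln ((real m + 2)\<^sup>2) / real m) \<longlonglongrightarrow> 0" by real_asymp
      from tendsto_mult_right_zero[OF this, of "real ?c"] show ?thesis by simp
    qed
    then have "(\<lambda>m. ln (real (?N m)) / real m) \<longlonglongrightarrow> 0"
      by (rule tendsto_sandwich[OF lower upper tendsto_const])
    then show ?thesis by (simp add: ent_cover_def limI)
  qed
  then have "ent T G = (SUP \<alpha> \<in> {\<alpha>. nonempty_open_cover T \<alpha>}. 0)"
    unfolding ent_def by (intro SUP_cong) (auto simp: zero_ereal_def)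
  moreover have "nonempty_open_cover T {topspace T}" by (simp add: nonempty_open_cover_def)
  ultimately show ?thesis by (metis SUP_const empty_iff mem_Collect_eq)
qed

text \<open>
  If each member of the cover contains at most one vertex, then each member of its power contains
  at most one walk, so the covering number equals the number of walks. Fekete's lemma gives the
  limit, and the walks spliced from two pieces bound it from below.
\<close>

lemma branching_imp_ent_neq_0:
  assumes "branching G" "finite G" "G \<subseteq> topspace T \<times> topspace T" "t1_space T"
  shows "ent T G \<noteq> 0"
proof -
  let ?V = "fst ` G \<union> snd ` G"
  let ?X = "topspace T"
  obtain v k a b r where ab: "closed_walk G v k a" "closed_walk G v k b" "r < k" "a r \<noteq> b r"
    using assms(1) by (auto simp: branching_def)
  \<comment> \<open>Each member contains at most one vertex; finite sets being closed, the members are open.\<close>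
  define \<alpha> where "\<alpha> = (\<lambda>v. ?X - (?V - {v})) ` ?X"
  have "(a 1, a 0) \<in> G" using ab by (auto simp: closed_walk_def)
  then have "?X \<noteq> {}" using assms(3) by blast
  have V: "?V \<subseteq> ?X" using assms(3) by auto
  have "closedin T (?V - {v})" for v
    using assms V by (intro t1_space_closedin_finite[THEN iffD1, rule_format]) auto
  then have cover: "nonempty_open_cover T \<alpha>"
    using \<open>?X \<noteq> {}\<close> by (auto simp: nonempty_open_cover_def \<alpha>_def)
  let ?W = "mahavier_fin ?X G"
  let ?N = "\<lambda>m. min_cover_card (?W m) (cover_power \<alpha> (Suc m))"
  have N: "?N m = card (?W m)" if "m > 0" "?W m \<noteq> {}" for m
  proof (rule antisym)
    have fin: "finite (?W m)" using finite_mahavier_fin assms that by blast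
    show "?N m \<le> card (?W m)"
      using min_cover_card_le_card[OF fin that(2) mahavier_fin_subset_cover[OF cover]] .
    let ?C = "{card V | V. V \<subseteq> cover_power \<alpha> (Suc m) \<and> V \<noteq> {} \<and> finite V \<and> ?W m \<subseteq> \<Union> V}"
    have "card (?W m) \<le> c" if "c \<in> ?C" for c
    proof -
      obtain U where U: "c = card U" "U \<subseteq> cover_power \<alpha> (Suc m)" "finite U" "?W m \<subseteq> \<Union> U"
        using \<open>c \<in> ?C\<close> by auto
      have single: "x = y" if "P \<in> U" "x \<in> P" "y \<in> P" "x \<in> ?W m" "y \<in> ?W m" for P x y
      proof -
        obtain S where S: "P = Pi\<^sub>E {..<Suc m} S" "S \<in> {..<Suc m} \<rightarrow> \<alpha>"
          using subsetD[OF U(2) \<open>P \<in> U\<close>] by (auto simp: cover_power_def)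
        have "x i = y i" if "i < Suc m" for i
        proof -
          have "S i \<in> \<alpha>" using S(2) that by (simp add: Pi_iff)
          then obtain w where "S i = ?X - (?V - {w})" by (auto simp: \<alpha>_def)
          moreover have "x i \<in> S i" "y i \<in> S i" using S \<open>x \<in> P\<close> \<open>y \<in> P\<close> that by auto
          moreover have "x i \<in> ?V" "y i \<in> ?V"
            using mahavier_fin_vertex[OF \<open>m > 0\<close> \<open>x \<in> ?W m\<close>, of i]
              mahavier_fin_vertex[OF \<open>m > 0\<close> \<open>y \<in> ?W m\<close>, of i] that by simp_all
          ultimately show ?thesis by blast
        qed
        then show ?thesis using that unfolding mahavier_fin_def
          by (intro PiE_ext[of x "{..<Suc m}" _ y]) auto
      qed
      have "\<forall>x\<in>?W m. \<exists>P. x \<in> P \<and> P \<in> U" using U(4) by blast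
      then obtain f where f: "\<forall>x\<in>?W m. x \<in> f x \<and> f x \<in> U" by (auto dest!: bchoice)
      have "inj_on f (?W m)"
      proof (rule inj_onI)
        fix x y assume "x \<in> ?W m" "y \<in> ?W m" "f x = f y"
        then show "x = y" using single[of "f x" x y] f by auto
      qed
      then show ?thesis using f U by (auto intro: card_inj_on_le)
    qed
    moreover have "?C \<noteq> {}"
    proof -
      have "\<forall>x\<in>?W m. \<exists>P. x \<in> P \<and> P \<in> cover_power \<alpha> (Suc m)"
        using mahavier_fin_subset_cover[OF cover, of G m] by blast
      then obtain g where g: "\<forall>x\<in>?W m. x \<in> g x \<and> g x \<in> cover_power \<alpha> (Suc m)"
        by (auto dest!: bchoice)
      then have "g ` ?W m \<subseteq> cover_power \<alpha> (Suc m)" "g ` ?W m \<noteq> {}" "finite (g ` ?W m)"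
        "?W m \<subseteq> \<Union> (g ` ?W m)" using fin that by auto
      then show ?thesis by blast
    qed
    ultimately show "card (?W m) \<le> ?N m"
      unfolding min_cover_card_def by (meson cInf_greatest)
  qed
  have big: "2 ^ j \<le> card (?W (k * j))" if "j > 0" for j
    using branching_card_ge[OF ab assms(3,2) that] .
  have ne: "?W m \<noteq> {}" for m
  proof -
    have "restrict (spliced_walk k a b (\<lambda>_. True)) {..<Suc m} \<in> ?W m"
      using spliced_walk_in_mahavier_inf[OF ab(1,2) _ assms(3)] ab(3)
      by (fastforce simp: mahavier_fin_def mahavier_inf_def)
    then show ?thesis by blast
  qed
  have pos: "card (?W m) > 0" if "m > 0" for m
    using ne finite_mahavier_fin[OF assms(2) that] by (simp add: card_gt_0_iff)
  define s where "s m = ln (real (card (?W m)))" for m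
  have sN: "ln (real (?N m)) / real m = s m / real m" for m
    by (cases "m = 0") (simp_all add: N ne s_def)
  have "convergent (\<lambda>m. s m / real m)"
  proof (rule convergent_subadditive_div)
    fix m n :: nat assume mn: "m > 0" "n > 0"
    have "real (card (?W (m + n))) \<le> real (card (?W m)) * real (card (?W n))"
      using card_mahavier_fin_add[OF assms(2) mn, of ?X] by (metis of_nat_le_iff of_nat_mult)
    then have "s (m + n) \<le> ln (real (card (?W m)) * real (card (?W n)))"
      unfolding s_def using pos[of "m + n"] mn by (intro ln_mono) auto
    also have "\<dots> = s m + s n" using pos mn by (simp add: s_def ln_mult)
    finally show "s (m + n) \<le> s m + s n" .
  next
    fix n :: nat assume "n > 0"
    then show "s n \<ge> 0" using pos[of n] by (simp add: s_def)
  qed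
  then obtain L where L: "(\<lambda>m. s m / real m) \<longlonglongrightarrow> L" by (auto simp: convergent_def)
  have "k > 0" using ab(3) by simp
  have "(\<lambda>j. s (k * j) / real (k * j)) \<longlonglongrightarrow> L"
    using LIMSEQ_subseq_LIMSEQ[OF L, of "\<lambda>j. k * j"] \<open>k > 0\<close> by (simp add: strict_mono_def o_def)
  moreover have "ln 2 / real k \<le> s (k * j) / real (k * j)" if "j \<ge> 1" for j
  proof -
    have "real j * ln 2 = ln (real (2 ^ j))" by (simp add: ln_realpow)
    also have "\<dots> \<le> s (k * j)"
      unfolding s_def using big[of j] that by (intro ln_mono) (auto simp flip: of_nat_power)
    finally show ?thesis using that \<open>k > 0\<close> by (simp add: field_simps)
  qed
  ultimately have "ln 2 / real k \<le> L" by (meson LIMSEQ_le_const)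
  then have "0 < L" using \<open>k > 0\<close> by (smt (verit) divide_pos_pos ln_gt_zero of_nat_0_less_iff)
  moreover have "ent_cover T G \<alpha> = L"
    using L by (simp add: ent_cover_def sN limI)
  moreover have "ereal (ent_cover T G \<alpha>) \<le> ent T G"
    unfolding ent_def using cover by (intro SUP_upper) auto
  ultimately have "0 < ent T G" by (metis ereal_less(2) less_le_trans)
  then show ?thesis by simp
qed

section \<open>Metrics on the space of infinite walks\<close>

text \<open>
  Only the finitely many vertices occur as coordinates, and a finite subspace of a
  \<open>T\<^sub>1\<close> space is discrete. The topology on infinite walks thus forgets everything about
  the ambient space.
\<close>

lemma mahavier_topology_discrete:
  assumes "t1_space T" "finite G" "G \<subseteq> topspace T \<times> topspace T"
  shows "mahavier_topology T G =
    subtopology (product_topology (\<lambda>_. discrete_topology (fst ` G \<union> snd ` G)) UNIV)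
      (mahavier_inf (topspace T) G)"
proof -
  let ?V = "fst ` G \<union> snd ` G" and ?Y = "mahavier_inf (topspace T) G"
  have "subtopology T ?V = discrete_topology ?V"
    using assms by (intro subtopology_eq_discrete_topology_finite) auto
  then have "product_topology (\<lambda>_. discrete_topology ?V) (UNIV :: nat set) =
      subtopology (product_topology (\<lambda>_. T) UNIV) (\<Pi>\<^sub>E i\<in>UNIV. ?V)"
    by (simp add: subtopology_product_topology)
  moreover have "?Y \<subseteq> (\<Pi>\<^sub>E i\<in>UNIV. ?V)"
    by (force simp: mahavier_inf_def PiE_iff)
  ultimately show ?thesis
    by (simp add: mahavier_topology_def subtopology_subtopology inf_absorb2)
qed

lemma continuous_map_mahavier_coordinate:
  assumes "t1_space T" "finite G" "G \<subseteq> topspace T \<times> topspace T"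
  shows "continuous_map (mahavier_topology T G) (discrete_topology (fst ` G \<union> snd ` G)) (\<lambda>x. x i)"
  unfolding mahavier_topology_discrete[OF assms]
  by (intro continuous_map_from_subtopology continuous_map_product_projection) simp

text \<open>
  Every relation between two maps into a discrete space defines a closed set, since every subset of
  a discrete product is closed.
\<close>

lemma closedin_pair_discrete:
  assumes "continuous_map S (discrete_topology V) (\<lambda>x. f x)" "continuous_map S (discrete_topology V) (\<lambda>x. g x)"
  shows "closedin S {x \<in> topspace S. (f x, g x) \<in> R}"
proof -
  have "continuous_map S (discrete_topology (V \<times> V)) (\<lambda>x. (f x, g x))"
    unfolding prod_topology_discrete_topology using assms by (intro continuous_map_pairedI)
  then have "closedin S {x \<in> topspace S. (f x, g x) \<in> R \<inter> (V \<times> V)}"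
    by (intro closedin_continuous_map_preimage[where Y = "discrete_topology (V \<times> V)"]) auto
  moreover have "f x \<in> V" "g x \<in> V" if "x \<in> topspace S" for x
    using assms that by (auto simp: continuous_map_def)
  then have "{x \<in> topspace S. (f x, g x) \<in> R \<inter> (V \<times> V)} = {x \<in> topspace S. (f x, g x) \<in> R}"
    by auto
  ultimately show ?thesis by simp
qed

lemma compact_space_mahavier_topology:
  assumes "t1_space T" "finite G" "G \<subseteq> topspace T \<times> topspace T"
  shows "compact_space (mahavier_topology T G)"
proof -
  let ?V = "fst ` G \<union> snd ` G"
  let ?P = "product_topology (\<lambda>_. discrete_topology ?V) (UNIV :: nat set)"
  have "compact_space ?P"
    using assms(2) by (simp add: compact_space_product_topology compact_space_discrete_topology)
  moreover have "closedin ?P {x \<in> topspace ?P. (x (Suc i), x i) \<in> G}" for i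
    by (intro closedin_pair_discrete[where V = ?V] continuous_map_product_projection) auto
  then have "closedin ?P (\<Inter>i. {x \<in> topspace ?P. (x (Suc i), x i) \<in> G})"
    by (intro closedin_Inter) auto
  moreover have "(\<Inter>i. {x \<in> topspace ?P. (x (Suc i), x i) \<in> G}) = mahavier_inf (topspace T) G"
    using assms(3) by (force simp: mahavier_inf_def PiE_iff)
  ultimately show ?thesis
    unfolding mahavier_topology_discrete[OF assms]
    by (metis closedin_compact_space compact_space_subtopology)
qed

lemma compact_space_decreasing_empty:
  fixes C :: "nat \<Rightarrow> 'b set"
  assumes "compact_space S" "\<And>n. closedin S (C n)" "\<And>n. C (Suc n) \<subseteq> C n" "(\<Inter>n. C n) = {}"
  obtains n where "C n = {}"
proof (rule ccontr)
  assume "\<not> thesis"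
  then have "C n \<noteq> {}" for n using that by blast
  moreover have "decseq C" using assms(3) by (rule decseq_SucI)
  ultimately have "(\<Inter>n. C n) \<noteq> {}" using assms(1,2) by (intro compact_space_imp_nest)
  then show False using assms(4) by contradiction
qed

lemma shift_iterate: "(shift ^^ n) x = (\<lambda>i. x (n + i))"
  by (induction n) (auto simp: shift_def)

text \<open>
  The metric \<open>\<rho>\<close> is only known through its topology. The estimates below are the consequences of
  compactness that replace an explicit formula: \<open>\<rho>\<close> is bounded, it is bounded below on walks
  with different first vertices, and it is uniformly small on walks with a long common beginning.
\<close>

locale finite_mahavier_metric = Metric_space "mahavier_inf X G" \<rho>
  for X :: "'a set" and G :: "('a \<times> 'a) set" and \<rho> +
  fixes T :: "'a topology"
  assumes finite_G: "finite G" and t1: "t1_space T" and topspace_T: "topspace T = X"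
    and G_sub: "G \<subseteq> X \<times> X" and mtopology_eq: "mtopology = mahavier_topology T G"
begin

abbreviation "Y \<equiv> mahavier_inf X G"

lemma compact_mtopology: "compact_space mtopology"
  using compact_space_mahavier_topology t1 finite_G G_sub topspace_T mtopology_eq by metis

lemma compact_pairs: "compact_space (prod_topology mtopology mtopology)"
  using compact_mtopology by (simp add: compact_space_prod_topology)

lemma continuous_distance:
  "continuous_map (prod_topology mtopology mtopology) euclideanreal (\<lambda>p. \<rho> (fst p) (snd p))"
  using continuous_map_metric[of "metric (Y, \<rho>)"] by (simp add: case_prod_unfold)

lemma closedin_coordinates:
  "closedin (prod_topology mtopology mtopology) {p \<in> Y \<times> Y. (fst p i, snd p i) \<in> R}"
proof -
  have c: "continuous_map mtopology (discrete_topology (fst ` G \<union> snd ` G)) (\<lambda>x. x i)"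
    using continuous_map_mahavier_coordinate t1 finite_G G_sub topspace_T mtopology_eq by metis
  have "continuous_map (prod_topology mtopology mtopology) (discrete_topology (fst ` G \<union> snd ` G)) (\<lambda>p. fst p i)"
    using continuous_map_compose[OF continuous_map_fst c] by (simp add: o_def)
  moreover have "continuous_map (prod_topology mtopology mtopology) (discrete_topology (fst ` G \<union> snd ` G)) (\<lambda>p. snd p i)"
    using continuous_map_compose[OF continuous_map_snd c] by (simp add: o_def)
  ultimately show ?thesis
    using closedin_pair_discrete by fastforce
qed

lemma distance_bounded: "\<exists>D. \<forall>x\<in>Y. \<forall>y\<in>Y. \<rho> x y \<le> D"
  using compact_mtopology compactin_imp_mbounded[of Y]
  by (auto simp: compact_space_def mbounded_alt)

text \<open>
  The pairs of walks with different first vertices and distance at most \<open>1 / (n + 1)\<close> form a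
  decreasing sequence of closed sets in a compact space. A common point would be a pair of
  different walks at distance 0, so one of the sets is empty.
\<close>

lemma distance_lower_bound: "\<exists>\<delta>>0. \<forall>x\<in>Y. \<forall>y\<in>Y. x 0 \<noteq> y 0 \<longrightarrow> \<delta> \<le> \<rho> x y"
proof -
  define C where "C n = {p \<in> Y \<times> Y. (fst p 0, snd p 0) \<in> - Id} \<inter>
      {p \<in> topspace (prod_topology mtopology mtopology). \<rho> (fst p) (snd p) \<in> {..1 / real (Suc n)}}" for n
  obtain n where n: "C n = {}"
  proof (rule compact_space_decreasing_empty[OF compact_pairs])
    show "closedin (prod_topology mtopology mtopology) (C n)" for n
      unfolding C_def
      by (intro closedin_Int closedin_coordinates closedin_continuous_map_preimage[OF continuous_distance]) auto
    have "1 / real (Suc (Suc n)) \<le> 1 / real (Suc n)" for n by (simp add: field_simps)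
    then show "C (Suc n) \<subseteq> C n" for n unfolding C_def by (fastforce intro: order_trans)
    show "(\<Inter>n. C n) = {}"
    proof (rule ccontr)
      assume "(\<Inter>n. C n) \<noteq> {}"
      then obtain x y where xy: "\<And>n. (x, y) \<in> C n" by auto
      then have "x \<in> Y" "y \<in> Y" "x \<noteq> y" unfolding C_def by auto
      then have "\<rho> x y > 0" by (simp add: mdist_pos_less)
      then obtain n where "1 / real (Suc n) < \<rho> x y" using nat_approx_posE by blast
      then show False using xy[of n] by (simp add: C_def)
    qed
  qed (use that in blast)
  have "1 / real (Suc n) \<le> \<rho> x y" if "x \<in> Y" "y \<in> Y" "x 0 \<noteq> y 0" for x y
  proof (rule ccontr)
    assume "\<not> ?thesis"
    then have "(x, y) \<in> C n" using that by (simp add: C_def)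
    then show False using n by blast
  qed
  then show ?thesis by (intro exI[of _ "1 / real (Suc n)"]) auto
qed

text \<open>
  Here the closed sets consist of the pairs at distance at least \<open>\<epsilon>\<close> that agree up to
  time \<open>n\<close>; two walks that agree for all times are equal.
\<close>

lemma distance_small:
  assumes "\<epsilon> > 0"
  shows "\<exists>L. \<forall>x\<in>Y. \<forall>y\<in>Y. (\<forall>i<L. x i = y i) \<longrightarrow> \<rho> x y < \<epsilon>"
proof -
  define C where "C n = {p \<in> topspace (prod_topology mtopology mtopology). \<rho> (fst p) (snd p) \<in> {\<epsilon>..}} \<inter>
      (\<Inter>i\<in>{..n}. {p \<in> Y \<times> Y. (fst p i, snd p i) \<in> Id})" for n
  obtain n where n: "C n = {}"
  proof (rule compact_space_decreasing_empty[OF compact_pairs])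
    show "closedin (prod_topology mtopology mtopology) (C n)" for n
    proof -
      have "closedin (prod_topology mtopology mtopology) (\<Inter>i\<in>{..n}. {p \<in> Y \<times> Y. (fst p i, snd p i) \<in> Id})"
      proof (rule closedin_Inter)
        show "(\<lambda>i. {p \<in> Y \<times> Y. (fst p i, snd p i) \<in> Id}) ` {..n} \<noteq> {}" by simp
      qed (elim imageE, simp only: closedin_coordinates)
      then show ?thesis unfolding C_def
        by (intro closedin_Int closedin_continuous_map_preimage[OF continuous_distance]) auto
    qed
    show "C (Suc n) \<subseteq> C n" for n unfolding C_def by auto
    show "(\<Inter>n. C n) = {}"
    proof (rule ccontr)
      assume "(\<Inter>n. C n) \<noteq> {}"
      then obtain x y where xy: "\<And>n. (x, y) \<in> C n" by auto
      then have "x \<in> Y" "\<rho> x y \<ge> \<epsilon>" using xy[of 0] by (auto simp: C_def)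
      moreover have "x i = y i" for i using xy[of i] by (auto simp: C_def)
      then have "x = y" by blast
      ultimately show False using \<open>\<epsilon> > 0\<close> by simp
    qed
  qed (use that in blast)
  have "\<rho> x y < \<epsilon>" if "x \<in> Y" "y \<in> Y" "\<forall>i<Suc n. x i = y i" for x y
  proof (rule ccontr)
    assume "\<not> ?thesis"
    then have "(x, y) \<in> C n" using that by (auto simp: C_def)
    then show False using n by blast
  qed
  then show ?thesis by blast
qed

end

section \<open>Averages of sequences and the two kinds of chaos\<close>

lemma liminf_eq_0_iff:
  fixes a :: "nat \<Rightarrow> real"
  assumes "\<And>n. a n \<ge> 0"
  shows "liminf (\<lambda>n. ereal (a n)) = 0 \<longleftrightarrow> (\<forall>e>0. \<exists>\<^sub>F n in sequentially. a n < e)"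
proof -
  have "liminf (\<lambda>n. ereal (a n)) \<le> 0 \<longleftrightarrow> (\<forall>e>0. \<exists>\<^sub>F n in sequentially. a n < e)"
  proof
    assume le: "liminf (\<lambda>n. ereal (a n)) \<le> 0"
    show "\<forall>e>0. \<exists>\<^sub>F n in sequentially. a n < e"
    proof (intro allI impI)
      fix e :: real assume "e > 0"
      show "\<exists>\<^sub>F n in sequentially. a n < e"
      proof (rule ccontr)
        assume "\<not> ?thesis"
        then have "\<forall>\<^sub>F n in sequentially. ereal e \<le> ereal (a n)" by (simp add: not_frequently not_less)
        from Liminf_bounded[OF this] le \<open>e > 0\<close> show False
          by (metis ereal_less_eq(3) not_le order_trans zero_ereal_def)
      qed
    qed
  next
    assume freq: "\<forall>e>0. \<exists>\<^sub>F n in sequentially. a n < e"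
    show "liminf (\<lambda>n. ereal (a n)) \<le> 0"
    proof (rule ccontr)
      assume "\<not> ?thesis"
      then obtain e where e: "0 < ereal e" "ereal e < liminf (\<lambda>n. ereal (a n))"
        using ereal_dense2[of 0] by (metis not_le)
      have "\<forall>\<^sub>F n in sequentially. ereal e < ereal (a n)" by (rule less_LiminfD[OF e(2)])
      then have "\<not> (\<exists>\<^sub>F n in sequentially. a n < e)"
        by (auto simp: not_frequently elim: eventually_mono)
      then show False using freq e by simp
    qed
  qed
  moreover have "0 \<le> liminf (\<lambda>n. ereal (a n))"
    using assms by (intro Liminf_bounded) auto
  ultimately show ?thesis by auto
qed

lemma limsup_gt_0_iff:
  fixes a :: "nat \<Rightarrow> real"
  shows "limsup (\<lambda>n. ereal (a n)) > 0 \<longleftrightarrow> (\<exists>c>0. \<exists>\<^sub>F n in sequentially. a n > c)"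
proof
  assume "limsup (\<lambda>n. ereal (a n)) > 0"
  then obtain c where c: "0 < ereal c" "ereal c < limsup (\<lambda>n. ereal (a n))"
    using ereal_dense2 by blast
  have "\<exists>\<^sub>F n in sequentially. a n > c"
  proof (rule ccontr)
    assume "\<not> ?thesis"
    then have "\<forall>\<^sub>F n in sequentially. ereal (a n) \<le> ereal c" by (simp add: not_frequently not_less)
    from Limsup_bounded[OF this] c show False by simp
  qed
  then show "\<exists>c>0. \<exists>\<^sub>F n in sequentially. a n > c" using c by auto
next
  assume "\<exists>c>0. \<exists>\<^sub>F n in sequentially. a n > c"
  then obtain c where c: "c > 0" "\<exists>\<^sub>F n in sequentially. a n > c" by blast
  show "limsup (\<lambda>n. ereal (a n)) > 0"
  proof (rule ccontr)
    assume "\<not> ?thesis"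
    then have "limsup (\<lambda>n. ereal (a n)) < ereal c" using c
      by (metis ereal_less(2) le_less_trans not_less)
    then have "\<forall>\<^sub>F n in sequentially. ereal (a n) < ereal c" by (rule Limsup_lessD)
    then have "\<not> (\<exists>\<^sub>F n in sequentially. a n > c)"
      by (auto simp: not_frequently elim: eventually_mono)
    then show False using c by simp
  qed
qed

text \<open>
  If the terms were eventually at least \<open>e\<close>, the averages would eventually be at
  least \<open>e / 2\<close>, as an initial segment loses its weight.
\<close>

lemma frequently_small_of_averages:
  fixes a :: "nat \<Rightarrow> real"
  assumes nonneg: "\<And>n. a n \<ge> 0"
    and avg: "\<And>e. e > 0 \<Longrightarrow> \<exists>\<^sub>F n in sequentially. 1 / real n * (\<Sum>i=1..n. a i) < e"
    and "e > 0"
  shows "\<exists>\<^sub>F n in sequentially. a n < e"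
proof (rule ccontr)
  assume "\<not> ?thesis"
  then obtain N where N: "\<And>n. n \<ge> N \<Longrightarrow> a n \<ge> e"
    by (auto simp: not_frequently not_less eventually_sequentially)
  have "e / 2 \<le> 1 / real n * (\<Sum>i=1..n. a i)" if "n \<ge> 2 * N + 1" for n
  proof -
    have "e * (real n / 2) \<le> e * real (n - N)"
      using that \<open>e > 0\<close> by (intro mult_left_mono) (auto simp: of_nat_diff)
    also have "\<dots> = (\<Sum>i=Suc N..n. e)" by simp
    also have "\<dots> \<le> (\<Sum>i=Suc N..n. a i)" by (intro sum_mono N) auto
    also have "\<dots> \<le> (\<Sum>i=1..n. a i)" by (intro sum_mono2 nonneg) auto
    finally show ?thesis using that by (simp add: field_simps)
  qed
  then have "\<forall>\<^sub>F n in sequentially. \<not> 1 / real n * (\<Sum>i=1..n. a i) < e / 2"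
    by (auto simp: eventually_sequentially not_less)
  then show False using avg[of "e / 2"] \<open>e > 0\<close> by (simp add: frequently_def)
qed

text \<open>
  If the terms were eventually at most \<open>c / 2\<close>, the initial segment would contribute at most
  another \<open>c / 2\<close> to late averages.
\<close>

lemma frequently_large_of_averages:
  fixes a :: "nat \<Rightarrow> real"
  assumes avg: "\<exists>\<^sub>F n in sequentially. 1 / real n * (\<Sum>i=1..n. a i) > c"
    and nonneg: "\<And>n. a n \<ge> 0" and "c > 0"
  shows "\<exists>\<^sub>F n in sequentially. a n > c / 2"
proof (rule ccontr)
  assume "\<not> ?thesis"
  then obtain N where N: "\<And>n. n \<ge> N \<Longrightarrow> a n \<le> c / 2"
    by (auto simp: not_frequently not_less eventually_sequentially)
  define C where "C = (\<Sum>i=1..N. a i)"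
  have le: "(\<Sum>i=1..n. a i) \<le> C + real n * (c / 2)" for n
  proof -
    have "(\<Sum>i=1..n. a i) \<le> (\<Sum>i\<in>{1..N} \<union> {Suc N..n}. a i)" by (intro sum_mono2 nonneg) auto
    also have "\<dots> = C + (\<Sum>i=Suc N..n. a i)" unfolding C_def by (intro sum.union_disjoint) auto
    also have "(\<Sum>i=Suc N..n. a i) \<le> (\<Sum>i=Suc N..n. c / 2)" by (intro sum_mono N) auto
    also have "\<dots> \<le> real n * (c / 2)" using \<open>c > 0\<close> by simp
    finally show ?thesis by simp
  qed
  obtain M where "2 * C / c < real M" using reals_Archimedean2 by blast
  then have M: "C < real M * (c / 2)" using \<open>c > 0\<close> by (simp add: field_simps)
  have "1 / real n * (\<Sum>i=1..n. a i) \<le> c" if "n \<ge> Suc M" for n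
  proof -
    have "C \<le> real n * (c / 2)" using M that \<open>c > 0\<close>
      by (smt (verit, best) Suc_leD mult_right_mono of_nat_le_iff half_gt_zero)
    then have "(\<Sum>i=1..n. a i) \<le> real n * c" using le[of n] by simp
    then show ?thesis using that by (simp add: field_simps)
  qed
  then have "\<forall>\<^sub>F n in sequentially. \<not> 1 / real n * (\<Sum>i=1..n. a i) > c"
    by (auto simp: eventually_sequentially not_less)
  then show False using avg by (simp add: frequently_def)
qed

lemma dc2_pair_imp_li_yorke_pair:
  assumes nonneg: "\<And>x y. \<rho> x y \<ge> 0" and "dc2_pair \<rho> f x y"
  shows "li_yorke_pair \<rho> f x y"
proof -
  let ?a = "\<lambda>i. \<rho> ((f ^^ i) x) ((f ^^ i) y)"
  let ?avg = "\<lambda>n. 1 / real n * (\<Sum>i=1..n. ?a i)"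
  have pos: "?avg n \<ge> 0" for n by (simp add: nonneg sum_nonneg)
  from assms(2) have "x \<noteq> y" "liminf (\<lambda>n. ereal (?avg n)) = 0" "limsup (\<lambda>n. ereal (?avg n)) > 0"
    unfolding dc2_pair_def by blast+
  then have small: "\<And>e. e > 0 \<Longrightarrow> \<exists>\<^sub>F n in sequentially. ?avg n < e"
    and large: "\<exists>c>0. \<exists>\<^sub>F n in sequentially. ?avg n > c"
    unfolding liminf_eq_0_iff[OF pos] limsup_gt_0_iff by blast+
  have "liminf (\<lambda>n. ereal (?a n)) = 0"
    unfolding liminf_eq_0_iff[OF nonneg] using frequently_small_of_averages[OF nonneg small] by blast
  moreover obtain c where "c > 0" "\<exists>\<^sub>F n in sequentially. ?avg n > c" using large by blast
  then have "\<exists>\<^sub>F n in sequentially. ?a n > c / 2"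
    by (intro frequently_large_of_averages nonneg)
  then have "limsup (\<lambda>n. ereal (?a n)) > 0"
    unfolding limsup_gt_0_iff using \<open>c > 0\<close> half_gt_zero by blast
  ultimately show ?thesis using \<open>x \<noteq> y\<close> unfolding li_yorke_pair_def by blast
qed

section \<open>Bit streams and the Cantor set\<close>

abbreviation bit_streams :: "(nat \<Rightarrow> bool) topology" where
  "bit_streams \<equiv> product_topology (\<lambda>_. discrete_topology UNIV) UNIV"

lemma compact_space_bit_streams: "compact_space bit_streams"
  by (simp add: compact_space_product_topology compact_space_discrete_topology)

lemma bit_streams_eq_euclidean: "bit_streams = euclidean"
proof -
  have "discrete_topology (UNIV :: bool set) = euclidean"
    by (simp add: discrete_topology_unique open_discrete flip: open_openin)
  then show ?thesis by (metis euclidean_product_topology)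
qed

lemma ternary_summable: "summable (\<lambda>n. 2 * of_bool (a n) / 3 ^ Suc n :: real)"
proof (rule summable_comparison_test')
  show "summable (\<lambda>n. 2 / 3 * (1 / 3) ^ n :: real)" by (intro summable_mult summable_geometric) auto
  show "norm (2 * of_bool (a n) / 3 ^ Suc n :: real) \<le> 2 / 3 * (1 / 3) ^ n" for n
    by (simp add: power_one_over field_simps)
qed

text \<open>
  The partial sums depend on finitely many bits and are therefore continuous, and they converge
  uniformly.
\<close>

lemma continuous_ternary:
  "continuous_map bit_streams euclideanreal (\<lambda>a. \<Sum>n. 2 * of_bool (a n) / 3 ^ Suc n)"
proof -
  have "uniform_limit UNIV (\<lambda>N a. \<Sum>n<N. 2 * of_bool (a n) / 3 ^ Suc n :: real)
          (\<lambda>a. \<Sum>n. 2 * of_bool (a n) / 3 ^ Suc n) sequentially"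
  proof (rule Weierstrass_m_test_ev)
    show "summable (\<lambda>n. 2 / 3 * (1 / 3) ^ n :: real)" by (intro summable_mult summable_geometric) auto
    show "\<forall>\<^sub>F n in sequentially. \<forall>a\<in>UNIV. norm (2 * of_bool (a n) / 3 ^ Suc n :: real) \<le> 2 / 3 * (1 / 3) ^ n"
      by (simp add: power_one_over field_simps)
  qed
  moreover have "continuous_on UNIV (\<lambda>a :: nat \<Rightarrow> bool. \<Sum>n<N. 2 * of_bool (a n) / 3 ^ Suc n :: real)" for N
  proof (intro continuous_intros)
    fix n
    have "continuous_on UNIV ((\<lambda>b. of_bool b :: real) \<circ> (\<lambda>a :: nat \<Rightarrow> bool. a n))"
      by (intro continuous_on_compose continuous_on_product_coordinates) (simp add: continuous_on_discrete)
    then show "continuous_on UNIV (\<lambda>a :: nat \<Rightarrow> bool. of_bool (a n) :: real)" by (simp add: o_def)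
  qed auto
  ultimately have "continuous_on UNIV (\<lambda>a :: nat \<Rightarrow> bool. \<Sum>n. 2 * of_bool (a n) / 3 ^ Suc n :: real)"
    by (intro uniform_limit_theorem[where F = sequentially]) auto
  then show ?thesis by (simp add: bit_streams_eq_euclidean)
qed

text \<open>
  At the first position \<open>m\<close> where two bit streams differ, the digits contribute a difference of
  \<open>2 / 3 ^ Suc m\<close>, while all later digits together amount to at most \<open>1 / 3 ^ Suc m\<close>.
\<close>

lemma inj_ternary: "inj (\<lambda>a. \<Sum>n. 2 * of_bool (a n) / 3 ^ Suc n :: real)"
proof -
  let ?c = "\<lambda>a. \<Sum>n. 2 * of_bool (a n) / 3 ^ Suc n :: real"
  have less: "?c a < ?c b" if "\<And>n. n < m \<Longrightarrow> a n = b n" "\<not> a m" "b m" for a b :: "nat \<Rightarrow> bool" and m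
  proof -
    define t where "t n a = 2 * of_bool (a n) / (3 :: real) ^ Suc n" for n and a :: "nat \<Rightarrow> bool"
    have split: "?c x = (\<Sum>n. t (n + Suc m) x) + (\<Sum>n<Suc m. t n x)" for x
      unfolding t_def by (rule suminf_split_initial_segment[OF ternary_summable])
    have head: "(\<Sum>n<Suc m. t n b) = (\<Sum>n<Suc m. t n a) + 2 / 3 ^ Suc m"
      using that by (simp add: t_def)
    have "(\<lambda>n. 2 / 3 ^ (Suc m + 1) * (1 / 3) ^ n :: real) sums (2 / 3 ^ (Suc m + 1) * (1 / (1 - 1 / 3)))"
      by (intro sums_mult geometric_sums) auto
    then have S: "(\<lambda>n. 2 / 3 ^ (Suc m + 1) * (1 / 3) ^ n :: real) sums (1 / 3 ^ Suc m)"
      by (simp add: field_simps)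
    have sm: "summable (\<lambda>n. t (n + Suc m) x)" for x
      unfolding t_def by (rule summable_ignore_initial_segment[OF ternary_summable])
    have "(\<Sum>n. t (n + Suc m) a) \<le> 1 / 3 ^ Suc m"
      unfolding sums_unique[OF S]
      by (rule suminf_le[OF _ sm sums_summable[OF S]])
         (simp add: t_def power_add power_one_over field_simps)
    moreover have "0 \<le> (\<Sum>n. t (n + Suc m) b)" by (rule suminf_nonneg[OF sm]) (simp add: t_def)
    moreover have "1 / 3 ^ Suc m < (2 / 3 ^ Suc m :: real)" by (simp add: divide_strict_right_mono)
    ultimately show ?thesis unfolding split head by linarith
  qed
  show ?thesis
  proof (rule injI, rule ccontr)
    fix a b :: "nat \<Rightarrow> bool" assume eq: "?c a = ?c b" and "a \<noteq> b"
    then have ex: "\<exists>m. a m \<noteq> b m" by blast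
    define m where "m = (LEAST m. a m \<noteq> b m)"
    have "a m \<noteq> b m" using LeastI_ex[OF ex] by (simp add: m_def)
    moreover have "a n = b n" if "n < m" for n using not_less_Least that unfolding m_def by blast
    ultimately show False using less[of m a b] less[of m b a] eq by fastforce
  qed
qed

lemma bit_streams_homeomorphic_cantor_set: "bit_streams homeomorphic_space top_of_set cantor_set"
proof -
  let ?c = "\<lambda>a. \<Sum>n. 2 * of_bool (a n) / 3 ^ Suc n :: real"
  have img: "range ?c = cantor_set" by (auto simp: cantor_set_def)
  have "homeomorphic_map bit_streams (top_of_set cantor_set) ?c"
  proof (rule continuous_imp_homeomorphic_map)
    show "continuous_map bit_streams (top_of_set cantor_set) ?c"
      using continuous_ternary img by (auto simp: continuous_map_in_subtopology)
    show "?c ` topspace bit_streams = topspace (top_of_set cantor_set)" using img by simp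
    show "inj_on ?c (topspace bit_streams)" using inj_ternary by simp
  qed (auto simp: compact_space_bit_streams Hausdorff_space_subtopology)
  then show ?thesis by (rule homeomorphic_map_imp_homeomorphic_space)
qed

lemma uncountable_bit_streams: "uncountable (UNIV :: (nat \<Rightarrow> bool) set)"
proof
  assume "countable (UNIV :: (nat \<Rightarrow> bool) set)"
  then obtain f :: "nat \<Rightarrow> nat \<Rightarrow> bool" where "range f = UNIV"
    using uncountable_def by blast
  then obtain n where "f n = (\<lambda>i. \<not> f i i)" by (metis rangeE UNIV_I)
  then show False by metis
qed

lemma homeomorphic_cantor_set_uncountable:
  assumes "T homeomorphic_space top_of_set cantor_set"
  shows "uncountable (topspace T)"
proof
  assume c: "countable (topspace T)"
  have "T homeomorphic_space bit_streams"
    using assms bit_streams_homeomorphic_cantor_set homeomorphic_space_sym homeomorphic_space_trans by blast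
  then obtain f where "homeomorphic_map T bit_streams f" by (auto simp: homeomorphic_space)
  then have "f ` topspace T = (UNIV :: (nat \<Rightarrow> bool) set)"
    using homeomorphic_imp_surjective_map by fastforce
  then show False using c uncountable_bit_streams by (metis countable_image)
qed

section \<open>A scrambled Cantor set\<close>

definition block_index :: "nat \<Rightarrow> nat" where
  "block_index j = (LEAST n. j < fact (Suc n))"

lemma block_index_eq:
  assumes "fact n \<le> j" "j < fact (Suc n)"
  shows "block_index j = n"
  unfolding block_index_def
proof (rule Least_equality)
  fix m assume "j < fact (Suc m)"
  show "n \<le> m"
  proof (rule ccontr)
    assume "\<not> n \<le> m"
    then have "fact (Suc m) \<le> (fact n :: nat)" by (intro fact_mono) simp
    then show False using assms(1) \<open>j < fact (Suc m)\<close> by simp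
  qed
qed (use assms in simp)

text \<open>
  The decoding of pairs lets every bit of \<open>t\<close> recur in infinitely many even blocks: bit
  \<open>q\<close> is written in the blocks with index \<open>2 * prod_encode (q, m)\<close> for all \<open>m\<close>.
\<close>

definition block_code :: "(nat \<Rightarrow> bool) \<Rightarrow> nat \<Rightarrow> bool" where
  "block_code t j \<longleftrightarrow> even (block_index j) \<and> t (fst (prod_decode (block_index j div 2)))"

lemma block_code_odd:
  assumes "odd n" "fact n \<le> j" "j < fact (Suc n)"
  shows "\<not> block_code t j"
  using block_index_eq[OF assms(2,3)] assms(1) by (simp add: block_code_def)

lemma block_code_even:
  assumes "fact (2 * prod_encode (q, m)) \<le> j" "j < fact (Suc (2 * prod_encode (q, m)))"
  shows "block_code t j = t q"
  using block_index_eq[OF assms] by (simp add: block_code_def)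

text \<open>
  The upper bound for averages at the end of a block on which two walks agree. The first
  \<open>p\<close> terms precede the block; the last \<open>L\<close> terms see less than \<open>L\<close> common
  vertices before the block ends.
\<close>

lemma sum_le_if_small_in_middle:
  fixes c :: "nat \<Rightarrow> real"
  assumes "\<And>i. c i \<le> D" "0 \<le> D" "0 \<le> \<epsilon>"
    and mid: "\<And>i. p \<le> i \<Longrightarrow> i + L \<le> M \<Longrightarrow> c i \<le> \<epsilon>"
  shows "(\<Sum>i=1..M. c i) \<le> D * real (p + L) + \<epsilon> * real M"
proof -
  define A where "A = {..<p} \<union> {Suc M - L..M}"
  have "(\<Sum>i=1..M. c i) \<le> (\<Sum>i=1..M. (if i \<in> A then D else 0) + \<epsilon>)"
  proof (rule sum_mono)
    fix i assume "i \<in> {1..M}"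
    show "c i \<le> (if i \<in> A then D else 0) + \<epsilon>"
    proof (cases "i \<in> A")
      case True
      then show ?thesis using assms(1)[of i] assms(3) by simp
    next
      case False
      then show ?thesis using mid[of i] \<open>i \<in> {1..M}\<close> by (auto simp: A_def)
    qed
  qed
  also have "\<dots> = D * real (card ({1..M} \<inter> A)) + \<epsilon> * real M"
    by (simp add: sum.distrib sum.If_cases)
  also have "card ({1..M} \<inter> A) \<le> card A" by (intro card_mono) (auto simp: A_def)
  then have "card ({1..M} \<inter> A) \<le> p + L"
    using card_Un_le[of "{..<p}" "{Suc M - L..M}"] by (simp add: A_def)
  then have "D * real (card ({1..M} \<inter> A)) \<le> D * real (p + L)"
    using assms(2) by (intro mult_left_mono) auto
  finally show ?thesis by simp
qed

text \<open>
  The lower bound for averages at the end of a block on which two bit streams differ: each bit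
  position \<open>j\<close> contributes one large term.
\<close>

lemma sum_ge_if_large_once_per_block:
  fixes c :: "nat \<Rightarrow> real"
  assumes nonneg: "\<And>i. 0 \<le> c i" and "r < k" "1 \<le> p" "p \<le> q"
    and large: "\<And>j. p \<le> j \<Longrightarrow> j < q \<Longrightarrow> \<delta> \<le> c (k * j + r)"
  shows "real (q - p) * \<delta> \<le> (\<Sum>i=1..k * q. c i)"
proof -
  let ?h = "\<lambda>j. k * j + r"
  have "inj_on ?h {p..<q}" using \<open>r < k\<close> by (auto simp: inj_on_def)
  moreover have "?h ` {p..<q} \<subseteq> {1..k * q}"
  proof (intro image_subsetI)
    fix j assume j: "j \<in> {p..<q}"
    have "k * j + r \<le> k * Suc j" using \<open>r < k\<close> by simp
    also have "\<dots> \<le> k * q" using j by (intro mult_le_mono) auto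
    finally show "k * j + r \<in> {1..k * q}" using j assms(2,3) by (simp add: Suc_le_eq)
  qed
  ultimately have "(\<Sum>j=p..<q. c (?h j)) \<le> (\<Sum>i=1..k * q. c i)"
    using nonneg by (subst sum.reindex[of ?h "{p..<q}" c, unfolded o_def, symmetric]) (auto intro: sum_mono2)
  moreover have "(\<Sum>j=p..<q. \<delta>) \<le> (\<Sum>j=p..<q. c (?h j))" using large by (intro sum_mono) auto
  ultimately show ?thesis by simp
qed

context finite_mahavier_metric
begin

context
  fixes v :: 'a and k r :: nat and a b :: "nat \<Rightarrow> 'a"
  assumes a: "closed_walk G v k a" and b: "closed_walk G v k b" and r: "r < k" and ab: "a r \<noteq> b r"
begin

definition point :: "(nat \<Rightarrow> bool) \<Rightarrow> nat \<Rightarrow> 'a" where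
  "point t = spliced_walk k a b (block_code t)"

lemma point_in_Y: "point t \<in> Y"
  unfolding point_def using spliced_walk_in_mahavier_inf[OF a b _ G_sub] r by simp

lemma shift_in_Y: "x \<in> Y \<Longrightarrow> (shift ^^ n) x \<in> Y"
  by (simp add: shift_iterate mahavier_inf_def)

text \<open>
  Each vertex of the walk depends on a single bit of the parameter.
\<close>

lemma continuous_map_point: "continuous_map bit_streams mtopology point"
proof -
  let ?V = "fst ` G \<union> snd ` G"
  have "continuous_map bit_streams (discrete_topology ?V) (\<lambda>t. point t i)" for i
  proof -
    let ?q = "fst (prod_decode (block_index (i div k) div 2))"
    define h where "h z = (if even (block_index (i div k)) \<and> z then a else b) (i mod k)" for z
    have h: "point t i = h (t ?q)" for t
      by (simp add: point_def spliced_walk_def block_code_def h_def)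
    have "point t i \<in> ?V" for t
      using point_in_Y[of t] by (force simp: mahavier_inf_def)
    from this[unfolded h, of "\<lambda>_. z" for z] have "h z \<in> ?V" for z by blast
    then have "continuous_map (discrete_topology UNIV) (discrete_topology ?V) h" by auto
    moreover have "continuous_map bit_streams (discrete_topology UNIV) (\<lambda>t. t ?q)"
      by (intro continuous_map_product_projection) simp
    ultimately show ?thesis
      unfolding h using continuous_map_compose[of _ _ "\<lambda>t. t ?q" _ h] by (simp add: o_def)
  qed
  then show ?thesis
    using point_in_Y topspace_T mahavier_topology_discrete[OF t1 finite_G] G_sub
    by (auto simp: mtopology_eq continuous_map_in_subtopology continuous_map_componentwise_UNIV)
qed

lemma point_differ:
  assumes "s q \<noteq> t q" "fact (2 * prod_encode (q, m)) \<le> j" "j < fact (Suc (2 * prod_encode (q, m)))"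
  shows "point s (k * j + r) \<noteq> point t (k * j + r)"
  unfolding point_def using block_code_even[OF assms(2,3)] assms(1) r ab by (intro spliced_walk_differ) auto

lemma inj_point: "inj point"
proof (rule injI, rule ccontr)
  fix s t assume "point s = point t" "s \<noteq> t"
  then obtain q where q: "s q \<noteq> t q" by blast
  let ?n = "2 * prod_encode (q, 1)"
  have "1 \<le> prod_encode (q, 1)" by (rule le_prod_encode_2)
  then have "fact ?n < (fact (Suc ?n) :: nat)" by (intro fact_less_mono) auto
  from point_differ[where s = s and t = t, OF q order_refl this] \<open>point s = point t\<close>
  show False by simp
qed

lemma point_agree:
  assumes "odd n" "k * fact n \<le> i" "i < k * fact (Suc n)"
  shows "point s i = point t i"
proof -
  have "fact n \<le> i div k" "i div k < fact (Suc n)"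
    using assms r by (simp_all add: less_eq_div_iff_mult_less_eq div_less_iff_less_mult mult.commute)
  then show ?thesis
    using block_code_odd[OF assms(1)] by (simp add: point_def spliced_walk_def)
qed

text \<open>
  Averages are taken at the times \<open>M = k * fact (Suc n)\<close>, the ends of blocks. For odd
  \<open>n\<close> the time before the block is a fraction \<open>1 / (n + 1)\<close> of \<open>M\<close>, so the
  average is small. For even \<open>n\<close> of the form \<open>2 * prod_encode (q, m)\<close>, where
  \<open>q\<close> is a position with \<open>s q \<noteq> t q\<close>, a fraction \<open>n / (n + 1)\<close> of the bit
  positions contributes at least \<open>\<delta>\<close> once in \<open>k\<close> steps.
\<close>

lemma dc2_pair_point:
  assumes "s \<noteq> t"
  shows "dc2_pair \<rho> shift (point s) (point t)"
proof -
  let ?c = "\<lambda>i. \<rho> ((shift ^^ i) (point s)) ((shift ^^ i) (point t))"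
  let ?avg = "\<lambda>n. 1 / real n * (\<Sum>i=1..n. ?c i)"
  obtain q where q: "s q \<noteq> t q" using assms by blast
  have avg_nonneg: "?avg n \<ge> 0" for n by (simp add: sum_nonneg)
  have index_le: "n \<le> k * fact (Suc n)" for n
  proof -
    have "n \<le> fact (Suc n)" using fact_ge_self[of "Suc n"] by linarith
    also have "\<dots> \<le> k * fact (Suc n)" using r by simp
    finally show ?thesis .
  qed

  have "liminf (\<lambda>n. ereal (?avg n)) = 0"
    unfolding liminf_eq_0_iff[OF avg_nonneg]
  proof (intro allI impI)
    fix e :: real assume "e > 0"
    obtain L where L: "\<And>x y. x \<in> Y \<Longrightarrow> y \<in> Y \<Longrightarrow> \<forall>i<L. x i = y i \<Longrightarrow> \<rho> x y < e / 2"
      using distance_small[of "e / 2"] \<open>e > 0\<close> by auto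
    obtain D' where D': "\<And>x y. x \<in> Y \<Longrightarrow> y \<in> Y \<Longrightarrow> \<rho> x y \<le> D'"
      using distance_bounded by blast
    define D where "D = max D' 0"
    have c_le: "?c i \<le> D" for i
      using D'[OF shift_in_Y[OF point_in_Y] shift_in_Y[OF point_in_Y], of i s i t] by (simp add: D_def)
    show "\<exists>\<^sub>F n in sequentially. ?avg n < e"
      unfolding frequently_sequentially
    proof
      fix N
      \<comment> \<open>An odd \<open>n\<close> so large that the exceptional times contribute less than \<open>e / 2\<close>.\<close>
      obtain N' where N': "2 * D * (1 + real L) / e < real N'" using reals_Archimedean2 by blast
      define n where "n = 2 * max N N' + 1"
      have n: "odd n" "n \<ge> N" "real N' \<le> real (Suc n)" by (auto simp: n_def)
      define M where "M = k * fact (Suc n)"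
      have "(\<Sum>i=1..M. ?c i) \<le> D * real (k * fact n + L) + e / 2 * real M"
      proof (rule sum_le_if_small_in_middle[OF c_le])
        fix i assume i: "k * fact n \<le> i" "i + L \<le> M"
        have "point s (i + l) = point t (i + l)" if "l < L" for l
          using i that by (intro point_agree[OF n(1)]) (auto simp: M_def)
        then show "?c i \<le> e / 2"
          using L[OF shift_in_Y[OF point_in_Y] shift_in_Y[OF point_in_Y], of i s i t]
          by (simp add: shift_iterate)
      qed (use \<open>e > 0\<close> in \<open>auto simp: D_def\<close>)
      also have "D * real (k * fact n + L) \<le> D * ((1 + real L) * (real k * fact n))"
      proof (intro mult_left_mono)
        have "1 \<le> real k * fact n"
          using r mult_mono[of 1 "real k" 1 "fact n"] by simp
        then have "real L \<le> real L * (real k * fact n)" by (simp add: mult_le_cancel_left1)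
        then show "real (k * fact n + L) \<le> (1 + real L) * (real k * fact n)" by (simp add: algebra_simps)
      qed (simp add: D_def)
      also have "D * ((1 + real L) * (real k * fact n)) < e / 2 * real M"
      proof -
        have "D * (1 + real L) < e / 2 * real N'" using N' \<open>e > 0\<close> by (simp add: field_simps)
        also have "\<dots> \<le> e / 2 * real (Suc n)" using n(3) \<open>e > 0\<close> by (intro mult_left_mono) auto
        finally have "D * (1 + real L) * (real k * fact n) < e / 2 * real (Suc n) * (real k * fact n)"
          using r by (intro mult_strict_right_mono) auto
        then show ?thesis by (simp add: M_def algebra_simps)
      qed
      finally have "(\<Sum>i=1..M. ?c i) < e * real M" by simp
      moreover have "M > 0" using r by (simp add: M_def)
      ultimately have "?avg M < e" by (simp add: field_simps)
      moreover have "N \<le> M" using index_le[of n] n by (simp add: M_def)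
      ultimately show "\<exists>M\<ge>N. ?avg M < e" by blast
    qed
  qed

  moreover have "limsup (\<lambda>n. ereal (?avg n)) > 0"
    unfolding limsup_gt_0_iff
  proof -
    obtain \<delta> where \<delta>: "\<delta> > 0" "\<And>x y. x \<in> Y \<Longrightarrow> y \<in> Y \<Longrightarrow> x 0 \<noteq> y 0 \<Longrightarrow> \<delta> \<le> \<rho> x y"
      using distance_lower_bound by blast
    have "\<exists>\<^sub>F n in sequentially. ?avg n > \<delta> / (3 * real k)"
      unfolding frequently_sequentially
    proof
      fix N
      \<comment> \<open>The second component only serves to make \<open>n\<close> large.\<close>
      define n where "n = 2 * prod_encode (q, Suc N)"
      have "Suc N \<le> prod_encode (q, Suc N)" by (rule le_prod_encode_2)
      then have n: "1 \<le> n" "N \<le> n" by (auto simp: n_def)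
      define M where "M = k * fact (Suc n)"
      have "real (fact (Suc n) - fact n) * \<delta> \<le> (\<Sum>i=1..M. ?c i)"
        unfolding M_def
      proof (rule sum_ge_if_large_once_per_block[OF _ r])
        fix j :: nat assume "fact n \<le> j" "j < fact (Suc n)"
        then have "point s (k * j + r) \<noteq> point t (k * j + r)"
          using point_differ[where s = s and t = t, OF q, of "Suc N" j] by (simp add: n_def)
        then show "\<delta> \<le> ?c (k * j + r)"
          by (intro \<delta>(2) shift_in_Y point_in_Y) (simp add: shift_iterate)
      qed (auto intro: fact_mono)
      also have "real (fact (Suc n) - fact n) = real n * fact n" by simp
      finally have "real n * fact n * \<delta> \<le> (\<Sum>i=1..M. ?c i)" .
      moreover have "\<delta> / (3 * real k) * real M < real n * fact n * \<delta>"
      proof -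
        have "\<delta> / (3 * real k) * real M = \<delta> * fact n * (real (Suc n) / 3)"
          using r by (simp add: M_def field_simps)
        also have "\<dots> < \<delta> * fact n * real n" using n \<delta>(1) by (intro mult_strict_left_mono) auto
        finally show ?thesis by (simp add: algebra_simps)
      qed
      moreover have "M > 0" using r by (simp add: M_def)
      ultimately have "?avg M > \<delta> / (3 * real k)" by (simp add: pos_less_divide_eq)
      moreover have "N \<le> M" using index_le[of n] n by (simp add: M_def)
      ultimately show "\<exists>M\<ge>N. ?avg M > \<delta> / (3 * real k)" by blast
    qed
    moreover have "\<delta> / (3 * real k) > 0" using \<delta>(1) r by simp
    ultimately show "\<exists>c>0. \<exists>\<^sub>F n in sequentially. ?avg n > c" by blast
  qed
  moreover have "point s \<noteq> point t" using inj_point assms by (auto dest: injD)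
  ultimately show ?thesis unfolding dc2_pair_def by blast
qed

text \<open>
  A continuous injection from a compact space into a Hausdorff space is a homeomorphism onto its
  image, so the image of the bit streams is a Cantor set.
\<close>

lemma has_dc2_scrambled_cantor_set_of_walks: "has_dc2_scrambled_cantor_set Y \<rho> shift"
proof -
  have "homeomorphic_map bit_streams (subtopology mtopology (range point)) point"
  proof (rule continuous_imp_homeomorphic_map)
    show "continuous_map bit_streams (subtopology mtopology (range point)) point"
      using continuous_map_point by (auto simp: continuous_map_in_subtopology)
    show "point ` topspace bit_streams = topspace (subtopology mtopology (range point))"
      using point_in_Y by auto
    show "inj_on point (topspace bit_streams)" using inj_point by simp
  qed (auto simp: compact_space_bit_streams Hausdorff_space_subtopology Hausdorff_space_mtopology)
  then have "subtopology mtopology (range point) homeomorphic_space top_of_set cantor_set"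
    using bit_streams_homeomorphic_cantor_set homeomorphic_map_imp_homeomorphic_space
      homeomorphic_space_sym homeomorphic_space_trans by metis
  moreover have "dc2_scrambled \<rho> shift (range point)"
    unfolding dc2_scrambled_def
  proof (intro ballI impI)
    fix x y assume "x \<in> range point" "y \<in> range point" "x \<noteq> y"
    then obtain s t where st: "x = point s" "y = point t" by blast
    then have "s \<noteq> t" using \<open>x \<noteq> y\<close> by blast
    then show "dc2_pair \<rho> shift x y" unfolding st by (rule dc2_pair_point)
  qed
  moreover have "range point \<subseteq> Y" using point_in_Y by blast
  ultimately show ?thesis
    unfolding has_dc2_scrambled_cantor_set_def by (intro exI[of _ "range point"] conjI)
qed

end

lemma branching_imp_has_dc2_scrambled_cantor_set:
  "branching G \<Longrightarrow> has_dc2_scrambled_cantor_set Y \<rho> shift"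
  unfolding branching_def using has_dc2_scrambled_cantor_set_of_walks by blast

lemma has_dc2_scrambled_cantor_set_imp_li_yorke_chaotic:
  assumes "has_dc2_scrambled_cantor_set Y \<rho> shift"
  shows "li_yorke_chaotic Y \<rho> shift"
proof -
  obtain S where S: "S \<subseteq> Y" "dc2_scrambled \<rho> shift S"
    "subtopology mtopology S homeomorphic_space top_of_set cantor_set"
    using assms by (auto simp: has_dc2_scrambled_cantor_set_def)
  have "uncountable (topspace (subtopology mtopology S))"
    using S(3) by (rule homeomorphic_cantor_set_uncountable)
  moreover have "topspace (subtopology mtopology S) = S" using S(1) by auto
  moreover have "scrambled \<rho> shift S"
    unfolding scrambled_def
  proof (intro ballI impI)
    fix x y assume "x \<in> S" "y \<in> S" "x \<noteq> y"
    then have "dc2_pair \<rho> shift x y" using S(2) unfolding dc2_scrambled_def by blast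
    with nonneg show "li_yorke_pair \<rho> shift x y" by (rule dc2_pair_imp_li_yorke_pair)
  qed
  ultimately show ?thesis using S(1) unfolding li_yorke_chaotic_def by auto
qed

end

section \<open>The equivalence\<close>

theorem corollary7:
  fixes X :: "'a set" and d :: "'a \<Rightarrow> 'a \<Rightarrow> real"
    and G :: "('a \<times> 'a) set"
    and \<rho> :: "(nat \<Rightarrow> 'a) \<Rightarrow> (nat \<Rightarrow> 'a) \<Rightarrow> real"
  assumes "Metric_space X d"
    and "compact_space (Metric_space.mtopology X d)"
    and "finite G" and "G \<subseteq> X \<times> X"
    and "fst ` G \<subseteq> snd ` G"
    and "Metric_space (mahavier_inf X G) \<rho>"
    and "Metric_space.mtopology (mahavier_inf X G) \<rho> =
           mahavier_topology (Metric_space.mtopology X d) G"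
  shows "(ent (Metric_space.mtopology X d) G \<noteq> 0 \<longleftrightarrow>
            li_yorke_chaotic (mahavier_inf X G) \<rho> shift) \<and>
         (li_yorke_chaotic (mahavier_inf X G) \<rho> shift \<longleftrightarrow>
            has_dc2_scrambled_cantor_set (mahavier_inf X G) \<rho> shift)"
proof -
  let ?T = "Metric_space.mtopology X d"
  interpret X: Metric_space X d by fact
  have t1: "t1_space ?T" using X.Hausdorff_space_mtopology by (rule Hausdorff_imp_t1_space)
  have topspace: "topspace ?T = X" by simp
  interpret finite_mahavier_metric X G \<rho> ?T
    by (intro finite_mahavier_metric.intro finite_mahavier_metric_axioms.intro assms t1 topspace)
  show ?thesis
  proof (cases "branching G")
    case True
    have "ent ?T G \<noteq> 0" using branching_imp_ent_neq_0[OF True \<open>finite G\<close> _ t1] assms(4) topspace by simp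
    moreover have "has_dc2_scrambled_cantor_set Y \<rho> shift"
      using True by (rule branching_imp_has_dc2_scrambled_cantor_set)
    ultimately show ?thesis using has_dc2_scrambled_cantor_set_imp_li_yorke_chaotic by simp
  next
    case False
    have "ent ?T G = 0" using False \<open>finite G\<close> by (rule not_branching_imp_ent_eq_0)
    moreover have "\<not> li_yorke_chaotic Y \<rho> shift"
      using not_branching_countable[OF False \<open>finite G\<close>, of X]
      unfolding li_yorke_chaotic_def by (auto dest: countable_subset)
    ultimately show ?thesis using has_dc2_scrambled_cantor_set_imp_li_yorke_chaotic by blast
  qed
qed

end
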